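(* Fix integers $n\ge d\ge 1$ and $\lambda\in(0,1)$. Let $X^n(\cdot)$ and $\bar X^n(\cdot)$ be two Markov chains on $S^n$, both evolving according to the transition rates given in the context, with initial states satisfying $X^n(0)\le\bar X^n(0)$. Then there exists a coupling of the two chains (a construction of both on one probability space) such that $X^n(t)\le\bar X^n(t)$ for all $t\ge0$. In other words, $X^n(t)\le_{st}\bar X^n(t)$ for all $t\ge 0$.
   Context: For integers $n\ge d$ let $[n]=\{1,\dots,n\}$ be the set of servers and $m=\binom{n}{d}$. The $m$ subsets of $[n]$ of size $d$ are called classes and are indexed by $i\in[m]$. For a class $i\in[m]$, $\partial_i\subset[n]$ denotes the corresponding set of $d$ servers; for a server $j\in[n]$, $\partial_j\subset[m]$ denotes the set of classes containing $j$. The chains are continuous-time Markov chains on $S^n=\mathbb{Z}_+^m$ with transitions, from $x\in S^n$ and for each $i\in[m]$, $$x\to x+e_i\ \text{ at rate } r^{i,n}_+(x)=\frac{n\lambda}{m},\qquad x\to x-e_i\ \text{ at rate } r^{i,n}_-(x)=x_i\sum_{j\in\partial_i}\frac1{q_j},\qquad q_j=\sum_{i'\in\partial_j}x_{i'},$$ where $e_i$ is the $i$-th unit vector and $r^{i,n}_-(x)=0$ when $x_i=0$. For $x,y\in S^n$, $x\le y$ means $x_i\le y_i$ for all $i\in[m]$; $\le_{st}$ is the stochastic order on $S^n$-valued random variables induced by this partial order. *)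

theory Defs
  imports "HOL-Probability.Probability"
begin

section \<open>Continuous-time Markov chains on a countable state space\<close>

definition transition_function :: "'s set \<Rightarrow> (real \<Rightarrow> 's \<Rightarrow> 's pmf) \<Rightarrow> bool" where
  "transition_function S p \<longleftrightarrow>
     (\<forall>t\<ge>0. \<forall>x\<in>S. set_pmf (p t x) \<subseteq> S) \<and>
     (\<forall>x\<in>S. p 0 x = return_pmf x) \<and>
     (\<forall>s\<ge>0. \<forall>t\<ge>0. \<forall>x\<in>S. p (s + t) x = bind_pmf (p s x) (p t))"

text \<open>The matrix \<open>Q\<close> is the matrix of right derivatives at time 0.  Its off-diagonal entries are the
  transition rates and \<open>- Q x x\<close> is the total rate at which \<open>x\<close> is left.\<close>

definition has_generator :: "'s set \<Rightarrow> (real \<Rightarrow> 's \<Rightarrow> 's pmf) \<Rightarrow> ('s \<Rightarrow> 's \<Rightarrow> real) \<Rightarrow> bool" where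
  "has_generator S p Q \<longleftrightarrow>
     (\<forall>x\<in>S. \<forall>y\<in>S. ((\<lambda>t. pmf (p t x) y) has_real_derivative Q x y) (at 0 within {0..}))"

text \<open>Only times \<open>t \<ge> 0\<close> matter.  Right-continuity with respect to the discrete topology means that
  paths are constant for some time after each instant.\<close>

definition markov_chain ::
    "'s set \<Rightarrow> ('s \<Rightarrow> 's \<Rightarrow> real) \<Rightarrow> 'w measure \<Rightarrow> (real \<Rightarrow> 'w \<Rightarrow> 's) \<Rightarrow> bool" where
  "markov_chain S Q M X \<longleftrightarrow>
     prob_space M \<and>
     (\<forall>t\<ge>0. X t \<in> M \<rightarrow>\<^sub>M count_space S) \<and>
     (\<forall>\<omega>\<in>space M. \<forall>t\<ge>0. \<forall>\<^sub>F s in at_right t. X s \<omega> = X t \<omega>) \<and>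
     (\<exists>p. transition_function S p \<and> has_generator S p Q \<and>
        (\<forall>(k::nat) (t::nat \<Rightarrow> real) (x::nat \<Rightarrow> 's).
           0 \<le> t 0 \<and> (\<forall>l<k. t l \<le> t (Suc l)) \<and> (\<forall>l\<le>k. x l \<in> S) \<longrightarrow>
           measure M {\<omega>\<in>space M. \<forall>l\<le>k. X (t l) \<omega> = x l} =
             measure M {\<omega>\<in>space M. X (t 0) \<omega> = x 0} *
             (\<Prod>l<k. pmf (p (t (Suc l) - t l) (x l)) (x (Suc l)))))"

definition process_law ::
    "'s set \<Rightarrow> 'w measure \<Rightarrow> (real \<Rightarrow> 'w \<Rightarrow> 's) \<Rightarrow> (real \<Rightarrow> 's) measure" where
  "process_law S M X = distr M (\<Pi>\<^sub>M t\<in>{0..}. count_space S) (\<lambda>\<omega>. \<lambda>t\<in>{0..}. X t \<omega>)"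

definition stoch_le ::
    "'s::order set \<Rightarrow> 'v measure \<Rightarrow> ('v \<Rightarrow> 's) \<Rightarrow> 'w measure \<Rightarrow> ('w \<Rightarrow> 's) \<Rightarrow> bool" where
  "stoch_le S M X N Y \<longleftrightarrow>
     (\<forall>f::'s \<Rightarrow> real. mono_on S f \<and> bounded (f ` S) \<longrightarrow>
        (\<integral>\<omega>. f (X \<omega>) \<partial>M) \<le> (\<integral>\<omega>. f (Y \<omega>) \<partial>N))"


section \<open>The redundancy model\<close>

text \<open>Classes are indexed by themselves instead of by \<open>{1..n choose d}\<close>: a class \<open>c\<close> is the set of its
  \<open>d\<close> servers.  A state is a function on classes, extended by 0 to other sets, so that the pointwise
  order of functions is the coordinatewise order on states.\<close>

type_synonym state = "nat set \<Rightarrow> nat"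

definition classes :: "nat \<Rightarrow> nat \<Rightarrow> nat set set" where
  "classes n d = {c. c \<subseteq> {1..n} \<and> card c = d}"

definition states :: "nat \<Rightarrow> nat \<Rightarrow> state set" where
  "states n d = {x. \<forall>c. c \<notin> classes n d \<longrightarrow> x c = 0}"

definition queue :: "nat \<Rightarrow> nat \<Rightarrow> state \<Rightarrow> nat \<Rightarrow> nat" where
  "queue n d x j = (\<Sum>c\<in>{c \<in> classes n d. j \<in> c}. x c)"

definition rate_up :: "nat \<Rightarrow> nat \<Rightarrow> real \<Rightarrow> real" where
  "rate_up n d lam = real n * lam / real (n choose d)"

text \<open>If \<open>x c > 0\<close> then all the queues in the sum are positive; if \<open>x c = 0\<close> the rate is 0.\<close>

definition rate_down :: "nat \<Rightarrow> nat \<Rightarrow> nat set \<Rightarrow> state \<Rightarrow> real" where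
  "rate_down n d c x = real (x c) * (\<Sum>j\<in>c. 1 / real (queue n d x j))"

text \<open>Truncated subtraction at \<open>x c = 0\<close> is harmless, since the corresponding rate is 0.\<close>

definition generator :: "nat \<Rightarrow> nat \<Rightarrow> real \<Rightarrow> state \<Rightarrow> state \<Rightarrow> real" where
  "generator n d lam x y =
     (\<Sum>c\<in>classes n d. rate_up n d lam * of_bool (y = x(c := x c + 1))
                     + rate_down n d c x * of_bool (y = x(c := x c - 1)))
     - of_bool (y = x) * (\<Sum>c\<in>classes n d. rate_up n d lam + rate_down n d c x)"

abbreviation redundancy_chain ::
    "nat \<Rightarrow> nat \<Rightarrow> real \<Rightarrow> 'w measure \<Rightarrow> (real \<Rightarrow> 'w \<Rightarrow> state) \<Rightarrow> bool" where
  "redundancy_chain n d lam \<equiv> markov_chain (states n d) (generator n d lam)"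

text \<open>A coupling of the processes \<open>X\<close> on \<open>M\<close> and \<open>X'\<close> on \<open>M'\<close>: copies \<open>Y\<close>, \<open>Y'\<close> of the two chains on
  one probability space \<open>P\<close>.\<close>

definition coupling ::
    "'s set \<Rightarrow> ('s \<Rightarrow> 's \<Rightarrow> real) \<Rightarrow> 'v measure \<Rightarrow> (real \<Rightarrow> 'v \<Rightarrow> 's) \<Rightarrow> 'w measure \<Rightarrow> (real \<Rightarrow> 'w \<Rightarrow> 's) \<Rightarrow>
     'p measure \<Rightarrow> (real \<Rightarrow> 'p \<Rightarrow> 's) \<Rightarrow> (real \<Rightarrow> 'p \<Rightarrow> 's) \<Rightarrow> bool" where
  "coupling S Q M X M' X' P Y Y' \<longleftrightarrow>
     markov_chain S Q P Y \<and> markov_chain S Q P Y' \<and>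
     process_law S P Y = process_law S M X \<and>
     process_law S P Y' = process_law S M' X'"

text \<open>Couplings are sought on a sample space of pairs of paths.  This is no restriction: a coupling on
  any other space can be transported along \<open>\<omega> \<mapsto> ((\<lambda>t. Y t \<omega>), (\<lambda>t. Y' t \<omega>))\<close>.\<close>

type_synonym path_pair = "(real \<Rightarrow> state) \<times> (real \<Rightarrow> state)"

end

theory Submission imports Defs begin

text \<open>The total jump rate is at most \<open>n (1 + lam)\<close>, so the chain is a discrete chain run at the times of a
  Poisson process: with probability \<open>lam / (1 + lam)\<close> a job arrives, and otherwise a uniformly chosen
  server removes one of its jobs, chosen uniformly.  For \<open>x \<le> y\<close> the jobs of \<open>x\<close> at a server are among
  those of \<open>y\<close>.  Hence the server can choose a job for \<open>y\<close> first, reuse it for \<open>x\<close> if it is present there,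
  and otherwise choose a fresh job for \<open>x\<close>; in the second case \<open>y\<close> loses a job that \<open>x\<close> does not have, so
  the order is preserved.

  The transition probabilities of the given chains are determined by the generator: the difference from
  the uniformized ones over \<open>[0, t]\<close> telescopes into errors over steps of length \<open>h\<close>, which
  after division by \<open>h\<close> are bounded and tend to 0 pointwise, so that dominated convergence applies.  A
  version of the coupled chain with right-continuous paths comes from Kolmogorov's extension theorem,
  applied to the chain together with its Poisson clock, by taking limits along the rationals.\<close>

text \<open>The obstacle is that \<open>markov_chain\<close> only asserts that some transition
  function with the prescribed right derivatives at 0 exists: two chains might use different ones,
  and for unbounded rates uniqueness can fail. What helps is that a busy server removes jobs at
  total rate exactly 1, since the fractions x_c / q_j over the classes c at server j add up to 1. If
  an idle server makes a fictitious jump, every state has the same total rate L = n (1 + lam), and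
  the generator is L (K - I) with a stochastic kernel K. The uniqueness estimates are one-sided (u
  \<le> p + error), which suffices because both masses are 1; the only bound required of the unknown
  p is one on its probability of leaving a state.

  A second difficulty is that order and right continuity are demanded at every sample point and at
  uncountably many times. The order is therefore built into the state space of the coupled chain,
  null sets are repaired by constant paths, and the final sample space is cut down to good pairs of
  paths. The clock is there because the state itself is not monotone in time, which alone would not
  make right limits exist.\<close>

section \<open>Uniformized chains\<close>

text \<open>The library's \<^const>\<open>poisson_pmf\<close> requires a positive rate.\<close>

definition poisson0 :: "real \<Rightarrow> nat pmf" where
  "poisson0 a = (if a = 0 then return_pmf 0 else poisson_pmf a)"

lemma pmf_poisson0: "0 \<le> a \<Longrightarrow> pmf (poisson0 a) k = a ^ k / fact k * exp (- a)"
  by (auto simp: poisson0_def power_0_left)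

text \<open>The convolution of the two weights is the binomial theorem for
  \<open>(a + b) ^ k\<close>, divided by \<open>fact k\<close>.\<close>

lemma poisson0_add:
  assumes "0 \<le> a" "0 \<le> b"
  shows "bind_pmf (poisson0 a) (\<lambda>i. map_pmf (\<lambda>j. i + j) (poisson0 b)) = poisson0 (a + b)"
proof (rule pmf_eqI)
  fix k
  have inner: "pmf (map_pmf (\<lambda>j. i + j) (poisson0 b)) k = (if i \<le> k then pmf (poisson0 b) (k - i) else 0)" for i
  proof (cases "i \<le> k")
    case True
    then show ?thesis
      using pmf_map_inj'[of "\<lambda>j. i + j" "poisson0 b" "k - i"] by (simp add: inj_def)
  next
    case False
    then show ?thesis by (auto simp: pmf_eq_0_set_pmf)
  qed
  have "pmf (bind_pmf (poisson0 a) (\<lambda>i. map_pmf (\<lambda>j. i + j) (poisson0 b))) k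
      = measure_pmf.expectation (poisson0 a) (\<lambda>i. if i \<le> k then pmf (poisson0 b) (k - i) else 0)"
    by (simp add: pmf_bind inner)
  also have "\<dots> = (\<Sum>i\<le>k. pmf (poisson0 a) i * pmf (poisson0 b) (k - i))"
    by (subst integral_measure_pmf_real[where A = "{..k}"]) (auto simp: mult.commute split: if_splits)
  also have "\<dots> = (\<Sum>i\<le>k. real (k choose i) * a ^ i * b ^ (k - i)) / fact k * exp (- (a + b))"
    using assms by (simp add: pmf_poisson0 sum_distrib_right sum_divide_distrib binomial_fact exp_add exp_diff
        exp_minus field_simps)
  also have "\<dots> = pmf (poisson0 (a + b)) k"
    using assms by (simp add: pmf_poisson0 binomial_ring mult.commute mult.left_commute)
  finally show "pmf (bind_pmf (poisson0 a) (\<lambda>i. map_pmf (\<lambda>j. i + j) (poisson0 b))) k = pmf (poisson0 (a + b)) k" .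
qed

primrec iter_pmf :: "('s \<Rightarrow> 's pmf) \<Rightarrow> nat \<Rightarrow> 's \<Rightarrow> 's pmf" where
  "iter_pmf K 0 x = return_pmf x"
| "iter_pmf K (Suc k) x = bind_pmf (K x) (iter_pmf K k)"

lemma iter_pmf_add: "iter_pmf K (i + j) x = bind_pmf (iter_pmf K i x) (iter_pmf K j)"
  by (induction i arbitrary: x) (simp_all add: bind_return_pmf bind_assoc_pmf cong: bind_pmf_cong)

lemma set_iter_pmf:
  assumes "\<And>x. x \<in> S \<Longrightarrow> set_pmf (K x) \<subseteq> S" "x \<in> S"
  shows "set_pmf (iter_pmf K k x) \<subseteq> S"
  using assms(2)
proof (induction k arbitrary: x)
  case (Suc k)
  with assms(1)[of x] show ?case by fastforce
qed simp

text \<open>Lumping of a Markov chain. The intertwining is required only on a closed set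
  \<open>S\<close>, because the first component of the coupled step is a single step only at ordered
  pairs.\<close>

lemma map_iter_pmf:
  assumes "\<And>x. x \<in> S \<Longrightarrow> set_pmf (K x) \<subseteq> S"
    and "\<And>x. x \<in> S \<Longrightarrow> map_pmf g (K x) = K' (g x)" and "x \<in> S"
  shows "map_pmf g (iter_pmf K k x) = iter_pmf K' k (g x)"
  using assms(3)
proof (induction k arbitrary: x)
  case (Suc k)
  have "map_pmf g (iter_pmf K (Suc k) x) = bind_pmf (K x) (\<lambda>y. map_pmf g (iter_pmf K k y))"
    by (simp add: map_bind_pmf)
  also have "\<dots> = bind_pmf (K x) (\<lambda>y. iter_pmf K' k (g y))"
    using assms(1)[OF Suc.prems] by (intro bind_pmf_cong refl Suc.IH) auto
  also have "\<dots> = bind_pmf (map_pmf g (K x)) (iter_pmf K' k)"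
    by (simp add: bind_map_pmf)
  finally show ?case
    by (simp add: assms(2)[OF Suc.prems])
qed simp

text \<open>The semigroup \<open>exp (t L (K - I))\<close>, written as a mixture of the iterates of
  \<open>K\<close> over the number of rings of a Poisson clock of rate \<open>L\<close>. As a
  \<open>pmf\<close> it has mass 1 by construction.\<close>

definition uniformized :: "real \<Rightarrow> ('s \<Rightarrow> 's pmf) \<Rightarrow> real \<Rightarrow> 's \<Rightarrow> 's pmf" where
  "uniformized L K t x = bind_pmf (poisson0 (L * t)) (\<lambda>k. iter_pmf K k x)"

lemma uniformized_0 [simp]: "uniformized L K 0 x = return_pmf x"
  by (simp add: uniformized_def poisson0_def bind_return_pmf)

lemma uniformized_add:
  assumes "0 \<le> L" "0 \<le> s" "0 \<le> t"
  shows "uniformized L K (s + t) x = bind_pmf (uniformized L K s x) (uniformized L K t)"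
proof -
  have "uniformized L K (s + t) x
      = bind_pmf (bind_pmf (poisson0 (L * s)) (\<lambda>i. map_pmf (\<lambda>j. i + j) (poisson0 (L * t)))) (\<lambda>k. iter_pmf K k x)"
    using assms by (simp add: uniformized_def distrib_left poisson0_add)
  also have "\<dots> = bind_pmf (poisson0 (L * s)) (\<lambda>i. bind_pmf (poisson0 (L * t))
      (\<lambda>j. bind_pmf (iter_pmf K i x) (iter_pmf K j)))"
    by (simp add: bind_assoc_pmf bind_map_pmf iter_pmf_add)
  also have "\<dots> = bind_pmf (poisson0 (L * s)) (\<lambda>i. bind_pmf (iter_pmf K i x)
      (\<lambda>y. bind_pmf (poisson0 (L * t)) (\<lambda>j. iter_pmf K j y)))"
    by (subst bind_commute_pmf) simp
  finally show ?thesis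
    by (simp add: uniformized_def[abs_def] bind_assoc_pmf)
qed

lemma set_uniformized:
  assumes "\<And>x. x \<in> S \<Longrightarrow> set_pmf (K x) \<subseteq> S" "x \<in> S"
  shows "set_pmf (uniformized L K t x) \<subseteq> S"
  using set_iter_pmf[of S K x] assms by (fastforce simp: uniformized_def)

lemma transition_function_uniformized:
  assumes "0 \<le> L" "\<And>x. x \<in> S \<Longrightarrow> set_pmf (K x) \<subseteq> S"
  shows "transition_function S (uniformized L K)"
  using assms set_uniformized[of S K]
  by (auto simp: transition_function_def uniformized_add)

lemma map_uniformized:
  assumes "\<And>x. x \<in> S \<Longrightarrow> set_pmf (K x) \<subseteq> S"
    and "\<And>x. x \<in> S \<Longrightarrow> map_pmf g (K x) = K' (g x)" and "x \<in> S"
  shows "map_pmf g (uniformized L K t x) = uniformized L K' t (g x)"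
  by (simp add: uniformized_def map_bind_pmf map_iter_pmf[of S K g K', OF assms])

lemma pmf_uniformized_sums:
  assumes "0 \<le> L" "0 \<le> t"
  shows "(\<lambda>k. (L * t) ^ k / fact k * exp (- (L * t)) * pmf (iter_pmf K k x) y) sums pmf (uniformized L K t x) y"
proof -
  have "ennreal (pmf (uniformized L K t x) y) =
      (\<integral>\<^sup>+k. ennreal (pmf (poisson0 (L * t)) k) * ennreal (pmf (iter_pmf K k x) y) \<partial>count_space UNIV)"
    by (simp add: uniformized_def ennreal_pmf_bind nn_integral_measure_pmf)
  also have "\<dots> = (\<Sum>k. ennreal (pmf (poisson0 (L * t)) k * pmf (iter_pmf K k x) y))"
    by (simp add: nn_integral_count_space_nat ennreal_mult)
  finally have "(\<lambda>k. ennreal (pmf (poisson0 (L * t)) k * pmf (iter_pmf K k x) y)) sums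
      ennreal (pmf (uniformized L K t x) y)"
    by (simp add: summable_sums)
  then have "(\<lambda>k. pmf (poisson0 (L * t)) k * pmf (iter_pmf K k x) y) sums pmf (uniformized L K t x) y"
    by (subst (asm) sums_ennreal) auto
  then show ?thesis
    using assms by (simp add: pmf_poisson0)
qed

text \<open>Termwise comparison of the two Poisson series. It lets errors made at all intermediate
  times be integrated against the single law at the final time, at the price of a factor
  \<open>exp (L * t)\<close>.\<close>

lemma pmf_uniformized_time_mono:
  assumes "0 \<le> L" "0 \<le> s" "s \<le> t"
  shows "pmf (uniformized L K s x) y \<le> exp (L * t) * pmf (uniformized L K t x) y"
proof (rule sums_le)
  show "(\<lambda>k. (L * s) ^ k / fact k * exp (- (L * s)) * pmf (iter_pmf K k x) y) sums pmf (uniformized L K s x) y"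
    using assms by (intro pmf_uniformized_sums) auto
  show "(\<lambda>k. exp (L * t) * ((L * t) ^ k / fact k * exp (- (L * t)) * pmf (iter_pmf K k x) y)) sums
      (exp (L * t) * pmf (uniformized L K t x) y)"
    using assms by (intro sums_mult pmf_uniformized_sums) auto
  fix k
  have "(L * s) ^ k / fact k * exp (- (L * s)) \<le> (L * t) ^ k / fact k * 1"
    using assms by (intro mult_mono divide_right_mono power_mono mult_left_mono) auto
  then have "(L * s) ^ k / fact k * exp (- (L * s)) * pmf (iter_pmf K k x) y
      \<le> (L * t) ^ k / fact k * pmf (iter_pmf K k x) y"
    by (intro mult_right_mono) auto
  also have "\<dots> = exp (L * t) * ((L * t) ^ k / fact k * exp (- (L * t)) * pmf (iter_pmf K k x) y)"
    by (simp add: exp_minus field_simps)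
  finally show "(L * s) ^ k / fact k * exp (- (L * s)) * pmf (iter_pmf K k x) y \<le> \<dots>" .
qed

text \<open>For \<open>x \<noteq> y\<close> the term without a ring vanishes, and every other term
  carries a factor \<open>h ^ k \<le> h\<close>. After division by \<open>h\<close> the bound is
  summable in \<open>y\<close> and independent of \<open>h\<close>, as dominated convergence
  needs.\<close>

lemma pmf_uniformized_off_diagonal:
  assumes "0 \<le> L" "0 \<le> h" "h \<le> 1" "x \<noteq> y"
  shows "pmf (uniformized L K h x) y \<le> h * (exp L * pmf (uniformized L K 1 x) y)"
proof (rule sums_le)
  show "(\<lambda>k. (L * h) ^ k / fact k * exp (- (L * h)) * pmf (iter_pmf K k x) y) sums pmf (uniformized L K h x) y"
    using assms by (intro pmf_uniformized_sums) auto
  show "(\<lambda>k. h * (exp L * ((L * 1) ^ k / fact k * exp (- (L * 1)) * pmf (iter_pmf K k x) y))) sums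
      (h * (exp L * pmf (uniformized L K 1 x) y))"
    using assms by (intro sums_mult pmf_uniformized_sums) auto
  fix k
  show "(L * h) ^ k / fact k * exp (- (L * h)) * pmf (iter_pmf K k x) y
      \<le> h * (exp L * ((L * 1) ^ k / fact k * exp (- (L * 1)) * pmf (iter_pmf K k x) y))"
  proof (cases k)
    case 0
    with assms show ?thesis by simp
  next
    case (Suc j)
    have "h ^ k \<le> h"
      using assms power_le_one[of h j] by (simp add: Suc mult_left_le)
    then have "(L * h) ^ k / fact k * exp (- (L * h)) \<le> L ^ k * h / fact k * 1"
      using assms unfolding power_mult_distrib
      by (intro mult_mono divide_right_mono mult_left_mono) auto
    then have "(L * h) ^ k / fact k * exp (- (L * h)) * pmf (iter_pmf K k x) y
        \<le> L ^ k * h / fact k * pmf (iter_pmf K k x) y"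
      by (intro mult_right_mono) auto
    also have "\<dots> = h * (exp L * ((L * 1) ^ k / fact k * exp (- (L * 1)) * pmf (iter_pmf K k x) y))"
      by (simp add: exp_minus field_simps)
    finally show ?thesis .
  qed
qed

text \<open>Only the event of no ring before \<open>t\<close> is kept, which has probability
  \<open>exp (- (L * t))\<close>.\<close>

lemma pmf_uniformized_diagonal:
  assumes "0 \<le> L" "0 \<le> t"
  shows "1 - L * t \<le> pmf (uniformized L K t x) x"
proof -
  have "1 - L * t \<le> exp (- (L * t))"
    using exp_ge_add_one_self[of "- (L * t)"] by simp
  also have "\<dots> \<le> pmf (uniformized L K t x) x"
    using sums_le[OF _ sums_If_finite_set[of "{0::nat}" "\<lambda>k. exp (- (L * t))"]
        pmf_uniformized_sums[OF assms, of K x x]] assms by (simp add: field_simps)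
  finally show ?thesis .
qed

text \<open>Up to the factor \<open>exp (- (L * t))\<close> the probability is a power series in
  \<open>L * t\<close> whose first two coefficients are the entries of the identity and of
  \<open>K\<close>; the product rule gives their difference.\<close>

lemma uniformized_derivative:
  assumes "0 \<le> L"
  shows "((\<lambda>t. pmf (uniformized L K t x) y) has_real_derivative L * (pmf (K x) y - of_bool (y = x)))
    (at 0 within {0..})"
proof -
  define q where "q k = pmf (iter_pmf K k x) y" for k
  have q: "0 \<le> q k" "q k \<le> 1" for k
    by (auto simp: q_def pmf_le_1)
  have "iter_pmf K 0 = return_pmf"
    by (rule ext) simp
  then have q01: "q 0 = of_bool (y = x)" "q 1 = pmf (K x) y"
    by (auto simp: q_def bind_return_pmf' indicator_def simp del: iter_pmf.simps(1))
  \<comment> \<open>The series converges for negative \<open>t\<close> as well, so \<open>g\<close>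
    can be differentiated at 0 from both sides; the restriction to \<open>{0..}\<close> comes at the
    end.\<close>
  define g where "g t = (\<Sum>k. q k / fact k * (L * t) ^ k)" for t
  have eq: "pmf (uniformized L K t x) y = exp (- (L * t)) * g t" if "0 \<le> t" for t
  proof -
    have "(\<lambda>k. (q k / fact k * (L * t) ^ k) * exp (- (L * t))) sums pmf (uniformized L K t x) y"
      using pmf_uniformized_sums[OF assms that, of K x y] by (simp add: q_def mult_ac)
    from sums_mult2[OF this, of "exp (L * t)"] have "(\<lambda>k. q k / fact k * (L * t) ^ k) sums
        (pmf (uniformized L K t x) y * exp (L * t))"
      by (simp add: mult.assoc flip: exp_add)
    then have "g t = pmf (uniformized L K t x) y * exp (L * t)"
      unfolding g_def by (simp add: sums_iff)
    then show ?thesis by (simp add: exp_minus field_simps)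
  qed
  have summ: "summable (\<lambda>k. (q k / fact k) * z ^ k)" for z :: real
  proof (rule summable_comparison_test')
    show "summable (\<lambda>k. \<bar>z\<bar> ^ k / fact k)"
      using summable_exp[of "\<bar>z\<bar>"] by (simp add: field_simps)
    show "norm (q k / fact k * z ^ k) \<le> \<bar>z\<bar> ^ k / fact k" if "0 \<le> k" for k
      using q[of k] by (simp add: abs_mult power_abs divide_right_mono mult_left_le_one_le)
  qed
  have "((\<lambda>z. \<Sum>k. (q k / fact k) * z ^ k) has_real_derivative (\<Sum>k. diffs (\<lambda>k. q k / fact k) k * 0 ^ k)) (at 0)"
    by (rule termdiffs_strong_converges_everywhere) (rule summ)
  moreover have "(\<Sum>k. diffs (\<lambda>k. q k / fact k) k * 0 ^ k) = q 1"
    by (subst powser_zero) (simp add: diffs_def)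
  ultimately have d: "((\<lambda>z. \<Sum>k. (q k / fact k) * z ^ k) has_real_derivative q 1) (at 0)"
    by simp
  have "(g has_real_derivative q 1 * L) (at 0)"
    unfolding g_def using d
    by (intro DERIV_chain2[where g = "\<lambda>t. L * t" and x = 0]) (auto intro!: derivative_eq_intros)
  moreover have "g 0 = q 0"
    unfolding g_def using powser_zero[of "\<lambda>k. q k / fact k"] by simp
  ultimately have "((\<lambda>t. exp (- (L * t)) * g t) has_real_derivative L * (q 1 - q 0)) (at 0)"
    by (auto intro!: derivative_eq_intros simp: algebra_simps)
  then have "((\<lambda>t. exp (- (L * t)) * g t) has_real_derivative L * (q 1 - q 0)) (at 0 within {0..})"
    by (rule DERIV_subset) simp
  then show ?thesis
    unfolding q01[symmetric]
    by (rule has_field_derivative_transform_within[where d = 1]) (auto simp: eq)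
qed


section \<open>Uniqueness of the transition function\<close>

text \<open>Keeps only the trajectories that pass through \<open>x\<close> at the intermediate
  time.\<close>

lemma pmf_bind_ge: "pmf p x * pmf (f x) y \<le> pmf (bind_pmf p f) y"
proof -
  have "pmf p x * pmf (f x) y = measure_pmf.expectation p (\<lambda>z. indicator {x} z * pmf (f x) y)"
    by (simp add: measure_pmf_single)
  also have "\<dots> \<le> measure_pmf.expectation p (\<lambda>z. pmf (f z) y)"
    by (intro integral_mono measure_pmf.integrable_const_bound[where B = 1])
      (auto simp: pmf_le_1 indicator_def)
  finally show ?thesis
    by (simp add: pmf_bind)
qed

text \<open>Passing to complements reverses the inequality, as both masses are 1. This is why
  one-sided estimates can identify a law.\<close>

lemma pmf_eqI_measure_le:
  assumes "\<And>A. measure_pmf.prob p A \<le> measure_pmf.prob q A"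
  shows "p = q"
proof (rule pmf_eqI)
  fix x
  have "1 - measure_pmf.prob p {x} \<le> 1 - measure_pmf.prob q {x}"
    using assms[of "- {x}"] measure_pmf.prob_compl[of "{x}" p] measure_pmf.prob_compl[of "{x}" q]
    by (simp add: Compl_eq_Diff_UNIV)
  then show "pmf p x = pmf q x"
    using assms[of "{x}"] by (simp add: measure_pmf_single)
qed

lemma right_derivative_sequentially:
  fixes f :: "real \<Rightarrow> real"
  assumes "(f has_real_derivative D) (at 0 within {0..})"
    and r: "filterlim r at_top sequentially" "\<And>n. 0 < r n" and "0 < t"
  shows "(\<lambda>n. r n * (f (t / r n) - f 0)) \<longlonglongrightarrow> t * D"
proof -
  have "((\<lambda>h. (f h - f 0) / h) \<longlongrightarrow> D) (at 0 within {0..})"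
    using assms(1) by (simp add: has_field_derivative_iff)
  moreover have "filterlim (\<lambda>n. t / r n) (at 0 within {0..}) sequentially"
    unfolding filterlim_at using r \<open>0 < t\<close>
    by (auto intro!: tendsto_divide_0[OF tendsto_const] filterlim_at_top_imp_at_infinity
        simp: less_imp_le less_imp_neq[symmetric])
  ultimately have "(\<lambda>n. (f (t / r n) - f 0) / (t / r n)) \<longlonglongrightarrow> D"
    by (rule filterlim_compose)
  then have "(\<lambda>n. t * ((f (t / r n) - f 0) / (t / r n))) \<longlonglongrightarrow> t * D"
    by (intro tendsto_intros)
  then show ?thesis
    using \<open>0 < t\<close> by (simp add: mult.commute)
qed

text \<open>The probability of being away from \<open>x\<close> is subadditive in time, hence at
  most \<open>n\<close> times its value at \<open>t / n\<close>, which tends to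
  \<open>- (t * Q x x)\<close>. So the derivative at 0 alone yields a bound at all times.\<close>

lemma transition_function_leave_bound:
  assumes p: "transition_function S p" "has_generator S p Q" and "x \<in> S" "- Q x x \<le> L" "0 \<le> t"
  shows "1 - pmf (p t x) x \<le> L * t"
proof (cases "t = 0")
  case True
  then show ?thesis using p(1) \<open>x \<in> S\<close> by (simp add: transition_function_def)
next
  case False
  then have "0 < t" using \<open>0 \<le> t\<close> by simp
  have sub: "1 - pmf (p (a + b) x) x \<le> (1 - pmf (p a x) x) + (1 - pmf (p b x) x)"
    if "0 \<le> a" "0 \<le> b" for a b
  proof -
    have "pmf (p a x) x * pmf (p b x) x \<le> pmf (p (a + b) x) x"
      using p(1) \<open>x \<in> S\<close> that pmf_bind_ge[of "p a x" x "p b" x] by (simp add: transition_function_def)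
    moreover have "0 \<le> (1 - pmf (p a x) x) * (1 - pmf (p b x) x)"
      by (intro mult_nonneg_nonneg) (auto simp: pmf_le_1)
    ultimately show ?thesis by (simp add: algebra_simps)
  qed
  have mult: "1 - pmf (p (real n * h) x) x \<le> real n * (1 - pmf (p h x) x)" if "0 \<le> h" for n h
  proof (induction n)
    case 0
    then show ?case using p(1) \<open>x \<in> S\<close> by (simp add: transition_function_def)
  next
    case (Suc n)
    then show ?case using sub[of h "real n * h"] that by (simp add: algebra_simps)
  qed
  have "(\<lambda>n. real (Suc n) * (pmf (p (t / real (Suc n)) x) x - pmf (p 0 x) x)) \<longlonglongrightarrow> t * Q x x"
    using p(2) \<open>x \<in> S\<close> \<open>0 < t\<close>
    by (intro right_derivative_sequentially[where f = "\<lambda>t. pmf (p t x) x"])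
      (auto simp: has_generator_def simp del: of_nat_Suc
        intro!: filterlim_compose[OF filterlim_real_sequentially filterlim_Suc])
  from tendsto_minus[OF this] have "(\<lambda>n. real (Suc n) * (1 - pmf (p (t / real (Suc n)) x) x)) \<longlonglongrightarrow> - (t * Q x x)"
    using p(1) \<open>x \<in> S\<close> by (simp add: transition_function_def algebra_simps)
  then have "1 - pmf (p t x) x \<le> - (t * Q x x)"
  proof (rule LIMSEQ_le_const)
    show "\<exists>N. \<forall>n\<ge>N. 1 - pmf (p t x) x \<le> real (Suc n) * (1 - pmf (p (t / real (Suc n)) x) x)"
      using mult[of "t / real (Suc n)" "Suc n" for n] \<open>0 < t\<close> by (simp del: of_nat_Suc)
  qed
  also have "\<dots> \<le> L * t"
    using mult_right_mono[OF assms(4) \<open>0 \<le> t\<close>] by (simp add: mult.commute)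
  finally show ?thesis .
qed

text \<open>This is the total variation distance: both masses are 1, so the positive part of the
  difference carries all of it. \<open>ennreal\<close> sends negative differences to 0.\<close>

definition pmf_excess :: "'s pmf \<Rightarrow> 's pmf \<Rightarrow> ennreal" where
  "pmf_excess p q = (\<integral>\<^sup>+w. ennreal (pmf p w - pmf q w) \<partial>count_space UNIV)"

lemma nn_integral_le_pmf_excess:
  fixes f :: "'s \<Rightarrow> ennreal"
  assumes "\<And>w. f w \<le> 1"
  shows "(\<integral>\<^sup>+w. f w \<partial>measure_pmf p) \<le> (\<integral>\<^sup>+w. f w \<partial>measure_pmf q) + pmf_excess p q"
proof -
  have "ennreal (pmf p w) * f w \<le> ennreal (pmf q w) * f w + ennreal (pmf p w - pmf q w)" for w
  proof -
    have "ennreal (pmf p w) \<le> ennreal (pmf q w) + ennreal (pmf p w - pmf q w)"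
      by (cases "pmf p w \<le> pmf q w") (auto simp: ennreal_leI ennreal_neg simp flip: ennreal_plus)
    then have "ennreal (pmf p w) * f w \<le> (ennreal (pmf q w) + ennreal (pmf p w - pmf q w)) * f w"
      by (rule mult_right_mono) simp
    also have "\<dots> \<le> ennreal (pmf q w) * f w + ennreal (pmf p w - pmf q w) * 1"
      unfolding distrib_right by (intro add_left_mono mult_left_mono assms) simp
    finally show ?thesis by simp
  qed
  then show ?thesis
    unfolding nn_integral_measure_pmf pmf_excess_def
    by (subst nn_integral_add[symmetric]) (auto intro!: nn_integral_mono)
qed

text \<open>The last step of \<open>u\<close> is exchanged for one of \<open>p\<close>, and the
  integral of \<open>f\<close> over that step becomes the next test function, still bounded by 1;
  hence \<open>f\<close> varies in the induction. The errors are averaged over positions drawn from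
  \<open>u\<close>, the semigroup about which bounds are known.\<close>

lemma nn_integral_telescope:
  fixes f :: "'s \<Rightarrow> ennreal"
  assumes "transition_function S u" "transition_function S p" "x \<in> S" "0 \<le> h" "\<And>w. f w \<le> 1"
  shows "(\<integral>\<^sup>+w. f w \<partial>measure_pmf (u (real k * h) x)) \<le> (\<integral>\<^sup>+w. f w \<partial>measure_pmf (p (real k * h) x))
    + (\<Sum>i<k. \<integral>\<^sup>+z. pmf_excess (u h z) (p h z) \<partial>measure_pmf (u (real i * h) x))"
  using assms(5)
proof (induction k arbitrary: f)
  case 0
  then show ?case using assms(1-3) by (simp add: transition_function_def)
next
  case (Suc k)
  have step: "q (real (Suc k) * h) x = bind_pmf (q (real k * h) x) (q h)" if "transition_function S q" for q
  proof -
    have "real (Suc k) * h = real k * h + h" by (simp add: algebra_simps)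
    then show ?thesis
      using that \<open>x \<in> S\<close> \<open>0 \<le> h\<close> unfolding transition_function_def by simp
  qed
  have le1: "(\<integral>\<^sup>+w. f w \<partial>measure_pmf (p h z)) \<le> 1" for z
    using nn_integral_mono[of "measure_pmf (p h z)" f "\<lambda>_. 1"] Suc.prems by simp
  have "(\<integral>\<^sup>+w. f w \<partial>measure_pmf (u (real (Suc k) * h) x))
      = (\<integral>\<^sup>+z. \<integral>\<^sup>+w. f w \<partial>measure_pmf (u h z) \<partial>measure_pmf (u (real k * h) x))"
    unfolding step[OF assms(1)] by simp
  also have "\<dots> \<le> (\<integral>\<^sup>+z. (\<integral>\<^sup>+w. f w \<partial>measure_pmf (p h z)) + pmf_excess (u h z) (p h z)
      \<partial>measure_pmf (u (real k * h) x))"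
    by (intro nn_integral_mono nn_integral_le_pmf_excess Suc.prems)
  also have "\<dots> = (\<integral>\<^sup>+z. (\<integral>\<^sup>+w. f w \<partial>measure_pmf (p h z)) \<partial>measure_pmf (u (real k * h) x))
      + (\<integral>\<^sup>+z. pmf_excess (u h z) (p h z) \<partial>measure_pmf (u (real k * h) x))"
    by (rule nn_integral_add) auto
  also have "\<dots> \<le> ((\<integral>\<^sup>+z. (\<integral>\<^sup>+w. f w \<partial>measure_pmf (p h z)) \<partial>measure_pmf (p (real k * h) x))
      + (\<Sum>i<k. \<integral>\<^sup>+z. pmf_excess (u h z) (p h z) \<partial>measure_pmf (u (real i * h) x)))
      + (\<integral>\<^sup>+z. pmf_excess (u h z) (p h z) \<partial>measure_pmf (u (real k * h) x))"
    by (intro add_right_mono Suc.IH le1)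
  finally show ?case
    unfolding step[OF assms(2)] by (simp add: add.assoc)
qed

text \<open>With \<open>N n\<close> steps, the telescoped error is at most
  \<open>exp (L * t)\<close> times the mean of \<open>N n * pmf_excess\<close> under the law at time
  \<open>t\<close>. Dominated convergence is used twice: over the target \<open>w\<close> within one
  step, then over the position \<open>z\<close>. The limit is 0 because \<open>u\<close> and
  \<open>p\<close> have the same derivative at 0.\<close>

theorem transition_function_unique:
  fixes K :: "'s \<Rightarrow> 's pmf"
  assumes L: "0 \<le> L" and K: "\<And>x. x \<in> S \<Longrightarrow> set_pmf (K x) \<subseteq> S"
    and p: "transition_function S p" "has_generator S p Q"
    and Q: "\<And>x y. x \<in> S \<Longrightarrow> y \<in> S \<Longrightarrow> Q x y = L * (pmf (K x) y - of_bool (y = x))"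
    and x: "x \<in> S" and t: "0 \<le> t"
  shows "p t x = uniformized L K t x"
proof (cases "t = 0")
  case True
  with p(1) x show ?thesis by (simp add: transition_function_def)
next
  case False
  with t have "0 < t" by simp
  let ?u = "uniformized L K"
  note u = transition_function_uniformized[OF L K]
  have p0: "p 0 z = return_pmf z" if "z \<in> S" for z
    using p(1) that by (simp add: transition_function_def)
  \<comment> \<open>The summand with the ceiling of \<open>t\<close> forces
    \<open>h n \<le> 1\<close>, as \<open>pmf_uniformized_off_diagonal\<close> requires.\<close>
  define N where "N n = Suc (n + nat \<lceil>t\<rceil>)" for n
  define h where "h n = t / real (N n)" for n
  have N: "0 < N n" "t \<le> N n" for n
    by (auto simp: N_def) linarith
  have h: "0 \<le> h n" "h n \<le> 1" "real (N n) * h n = t" for n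
    using N[of n] \<open>0 < t\<close> by (auto simp: h_def field_simps)
  have lim_N: "filterlim (\<lambda>n. real (N n)) at_top sequentially"
    unfolding N_def
    by (intro filterlim_compose[OF filterlim_real_sequentially] filterlim_compose[OF filterlim_Suc]
        filterlim_add_const_nat_at_top)
  \<comment> \<open>The first summand dominates off the diagonal (with
    \<open>N n * h n = t\<close>), the second on it, by the leave bound for \<open>p\<close>. The
    integral over \<open>w\<close> is the same for every \<open>z\<close>, so it also serves as the
    constant bound in the outer convergence.\<close>
  define bd where "bd z w = t * exp L * pmf (?u 1 z) w + L * t * indicator {z} w" for z w
  have bd_nonneg: "0 \<le> bd z w" for z w
    using L \<open>0 < t\<close> by (simp add: bd_def)
  have bd_int: "(\<integral>\<^sup>+w. ennreal (bd z w) \<partial>count_space UNIV) = ennreal (t * exp L + L * t)" for z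
  proof -
    have "(\<integral>\<^sup>+w. ennreal (indicator {z} w) \<partial>count_space UNIV) = 1"
      by (simp add: ennreal_indicator)
    then show ?thesis
      using L \<open>0 < t\<close> unfolding bd_def
      by (simp add: ennreal_plus ennreal_mult nn_integral_add nn_integral_cmult nn_integral_pmf
          measure_pmf.emeasure_space_1[simplified])
  qed
  have bd_le: "N n * (pmf (?u (h n) z) w - pmf (p (h n) z) w) \<le> bd z w" if "z \<in> S" for n z w
  proof (cases "w = z")
    case True
    have "- Q z z \<le> L"
      using that mult_nonneg_nonneg[OF L pmf_nonneg[of "K z" z]] Q[of z z] by (simp add: algebra_simps)
    have "N n * (pmf (?u (h n) z) w - pmf (p (h n) z) w) \<le> N n * (1 - pmf (p (h n) z) z)"
      unfolding True by (intro mult_left_mono diff_right_mono pmf_le_1) simp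
    also have "\<dots> \<le> N n * (L * h n)"
      using that h[of n] \<open>- Q z z \<le> L\<close>
      by (intro mult_left_mono transition_function_leave_bound[OF p]) auto
    also have "\<dots> = L * t"
      using h(3)[of n] by (simp add: mult.left_commute)
    also have "\<dots> \<le> bd z w"
      using \<open>0 < t\<close> by (simp add: bd_def True)
    finally show ?thesis .
  next
    case False
    have "N n * (pmf (?u (h n) z) w - pmf (p (h n) z) w) \<le> N n * pmf (?u (h n) z) w"
      by (intro mult_left_mono) auto
    also have "\<dots> \<le> N n * (h n * (exp L * pmf (?u 1 z) w))"
      using h[of n] L False by (intro mult_left_mono pmf_uniformized_off_diagonal) auto
    also have "\<dots> = (N n * h n) * (exp L * pmf (?u 1 z) w)"
      by simp
    also have "\<dots> = bd z w"
      using False by (simp add: bd_def h(3))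
    finally show ?thesis .
  qed
  have excess: "ennreal (N n) * pmf_excess (?u (h n) z) (p (h n) z)
      = (\<integral>\<^sup>+w. ennreal (N n * (pmf (?u (h n) z) w - pmf (p (h n) z) w)) \<partial>count_space UNIV)" for n z
    unfolding pmf_excess_def by (simp add: nn_integral_cmult ennreal_mult')
  have excess_le: "ennreal (N n) * pmf_excess (?u (h n) z) (p (h n) z) \<le> ennreal (t * exp L + L * t)"
    if "z \<in> S" for n z
    unfolding excess bd_int[of z, symmetric] by (intro nn_integral_mono ennreal_leI bd_le that)
  have excess_lim: "(\<lambda>n. ennreal (N n) * pmf_excess (?u (h n) z) (p (h n) z)) \<longlonglongrightarrow> 0" if z: "z \<in> S" for z
  proof -
    have "(\<lambda>n. \<integral>\<^sup>+w. ennreal (N n * (pmf (?u (h n) z) w - pmf (p (h n) z) w)) \<partial>count_space UNIV)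
        \<longlonglongrightarrow> (\<integral>\<^sup>+(w::'s). 0 \<partial>count_space UNIV)"
    proof (rule nn_integral_dominated_convergence[where w = "\<lambda>w. ennreal (bd z w)"])
      show "(\<integral>\<^sup>+w. ennreal (bd z w) \<partial>count_space UNIV) < \<infinity>"
        by (simp add: bd_int)
      have "(\<lambda>n. ennreal (N n * (pmf (?u (h n) z) w - pmf (p (h n) z) w))) \<longlonglongrightarrow> 0" for w
      proof (cases "w \<in> S")
        case True
        have "(\<lambda>n. N n * (pmf (?u (h n) z) w - pmf (?u 0 z) w)) \<longlonglongrightarrow> t * (L * (pmf (K z) w - of_bool (w = z)))"
          unfolding h_def
          using N(1) \<open>0 < t\<close>
          by (intro right_derivative_sequentially[where f = "\<lambda>t. pmf (?u t z) w"]
              uniformized_derivative[OF L] lim_N) auto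
        moreover have "(\<lambda>n. N n * (pmf (p (h n) z) w - pmf (p 0 z) w)) \<longlonglongrightarrow> t * Q z w"
          unfolding h_def
          using p(2) N(1) z True \<open>0 < t\<close>
          by (intro right_derivative_sequentially[where f = "\<lambda>t. pmf (p t z) w"] lim_N)
            (auto simp: has_generator_def)
        ultimately have "(\<lambda>n. N n * (pmf (?u (h n) z) w - pmf (?u 0 z) w)
            - N n * (pmf (p (h n) z) w - pmf (p 0 z) w)) \<longlonglongrightarrow> 0"
          using Q[OF z True] tendsto_diff by fastforce
        then have "(\<lambda>n. N n * (pmf (?u (h n) z) w - pmf (p (h n) z) w)) \<longlonglongrightarrow> 0"
          by (simp add: p0[OF z] algebra_simps)
        from tendsto_ennrealI[OF this] show ?thesis by simp
      next
        \<comment> \<open>\<open>has_generator\<close> gives no derivative towards targets outside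
          \<open>S\<close>; but \<open>u\<close> never reaches them, so the difference is
          nonpositive and its positive part is 0.\<close>
        case False
        then have "pmf (?u s z) w = 0" for s
          using set_uniformized[of S K z L s] K z by (auto simp: pmf_eq_0_set_pmf)
        then have "ennreal (N n * (pmf (?u (h n) z) w - pmf (p (h n) z) w)) = 0" for n
          by (simp add: ennreal_neg)
        then show ?thesis by simp
      qed
      then show "AE w in count_space UNIV. (\<lambda>n. ennreal (N n * (pmf (?u (h n) z) w - pmf (p (h n) z) w))) \<longlonglongrightarrow> 0"
        by simp
    qed (auto intro!: ennreal_leI bd_le z)
    then show ?thesis
      unfolding excess by simp
  qed
  have lim: "(\<lambda>n. \<integral>\<^sup>+z. ennreal (N n) * pmf_excess (?u (h n) z) (p (h n) z) \<partial>measure_pmf (?u t x))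
      \<longlonglongrightarrow> (\<integral>\<^sup>+z. 0 \<partial>measure_pmf (?u t x))"
  proof (rule nn_integral_dominated_convergence[where w = "\<lambda>_. ennreal (t * exp L + L * t)"])
    have sub: "set_pmf (?u t x) \<subseteq> S"
      using K x by (rule set_uniformized)
    show "AE z in measure_pmf (?u t x). ennreal (N n) * pmf_excess (?u (h n) z) (p (h n) z)
        \<le> ennreal (t * exp L + L * t)" for n
      using excess_le sub by (auto simp: AE_measure_pmf_iff)
    show "AE z in measure_pmf (?u t x). (\<lambda>n. ennreal (N n) * pmf_excess (?u (h n) z) (p (h n) z)) \<longlonglongrightarrow> 0"
      using excess_lim sub by (auto simp: AE_measure_pmf_iff)
  qed auto
  have main: "emeasure (measure_pmf (?u t x)) A \<le> emeasure (measure_pmf (p t x)) A" for A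
  proof (rule LIMSEQ_le_const)
    let ?I = "\<lambda>n. \<integral>\<^sup>+z. ennreal (N n) * pmf_excess (?u (h n) z) (p (h n) z) \<partial>measure_pmf (?u t x)"
    have "(\<lambda>n. emeasure (measure_pmf (p t x)) A + ennreal (exp (L * t)) * ?I n)
        \<longlonglongrightarrow> emeasure (measure_pmf (p t x)) A + ennreal (exp (L * t)) * 0"
      using lim by (intro tendsto_intros) (auto simp: ennreal_tendsto_cmult)
    then show "(\<lambda>n. emeasure (measure_pmf (p t x)) A + ennreal (exp (L * t)) * ?I n)
        \<longlonglongrightarrow> emeasure (measure_pmf (p t x)) A"
      by simp
    have "emeasure (measure_pmf (?u t x)) A \<le> emeasure (measure_pmf (p t x)) A + ennreal (exp (L * t)) * ?I n" for n
    proof -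
      \<comment> \<open>The law at time \<open>i * h n\<close> is traded for the one at time
        \<open>t\<close>, so that all \<open>N n\<close> summands get the same bound.\<close>
      have "(\<integral>\<^sup>+z. pmf_excess (?u (h n) z) (p (h n) z) \<partial>measure_pmf (?u (real i * h n) x))
          \<le> ennreal (exp (L * t)) * (\<integral>\<^sup>+z. pmf_excess (?u (h n) z) (p (h n) z) \<partial>measure_pmf (?u t x))"
        if "i < N n" for i
      proof -
        have "real i * h n \<le> t"
          using that h(1)[of n] h(3)[of n, symmetric] by (simp add: mult_right_mono)
        then have "ennreal (pmf (?u (real i * h n) x) z) \<le> ennreal (exp (L * t)) * ennreal (pmf (?u t x) z)" for z
          using pmf_uniformized_time_mono[OF L _ \<open>real i * h n \<le> t\<close>, of K x z] h(1)[of n]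
          by (simp add: ennreal_leI flip: ennreal_mult)
        then show ?thesis
          unfolding nn_integral_measure_pmf
          by (subst nn_integral_cmult[symmetric]) (auto intro!: nn_integral_mono mult_right_mono simp flip: mult.assoc)
      qed
      then have "(\<Sum>i<N n. \<integral>\<^sup>+z. pmf_excess (?u (h n) z) (p (h n) z) \<partial>measure_pmf (?u (real i * h n) x))
          \<le> (\<Sum>i<N n. ennreal (exp (L * t)) * (\<integral>\<^sup>+z. pmf_excess (?u (h n) z) (p (h n) z) \<partial>measure_pmf (?u t x)))"
        by (intro sum_mono) auto
      also have "\<dots> = ennreal (exp (L * t)) * ?I n"
        by (simp add: nn_integral_cmult ennreal_of_nat_eq_real_of_nat mult_ac)
      finally have "(\<Sum>i<N n. \<integral>\<^sup>+z. pmf_excess (?u (h n) z) (p (h n) z) \<partial>measure_pmf (?u (real i * h n) x))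
          \<le> ennreal (exp (L * t)) * ?I n" .
      moreover have "(\<integral>\<^sup>+w. indicator A w \<partial>measure_pmf (?u (real (N n) * h n) x))
          \<le> (\<integral>\<^sup>+w. indicator A w \<partial>measure_pmf (p (real (N n) * h n) x))
          + (\<Sum>i<N n. \<integral>\<^sup>+z. pmf_excess (?u (h n) z) (p (h n) z) \<partial>measure_pmf (?u (real i * h n) x))"
        using u p(1) x h(1)[of n] by (rule nn_integral_telescope) (auto simp: indicator_def)
      ultimately show ?thesis
        unfolding h(3) by simp (meson add_left_mono order_trans)
    qed
    then show "\<exists>M. \<forall>n\<ge>M. emeasure (measure_pmf (?u t x)) A
        \<le> emeasure (measure_pmf (p t x)) A + ennreal (exp (L * t)) * ?I n"
      by blast
  qed
  have "?u t x = p t x"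
    using main by (intro pmf_eqI_measure_le) (simp add: measure_pmf.emeasure_eq_measure)
  then show ?thesis by simp
qed


section \<open>Finite-dimensional distributions\<close>

primrec path_pmf :: "(real \<Rightarrow> 's \<Rightarrow> 's pmf) \<Rightarrow> real \<Rightarrow> 's \<Rightarrow> real list \<Rightarrow> 's list pmf" where
  "path_pmf p s x [] = return_pmf []"
| "path_pmf p s x (t # ts) = bind_pmf (p (t - s) x) (\<lambda>y. map_pmf (Cons y) (path_pmf p t y ts))"

lemma pmf_bind_map_Cons:
  "pmf (bind_pmf m (\<lambda>y. map_pmf (Cons y) (F y))) (a # as) = pmf m a * pmf (F a) as"
proof -
  have "pmf (map_pmf (Cons y) (F y)) (a # as) = indicator {a} y * pmf (F a) as" for y
    using pmf_map_inj'[of "Cons a" "F a" as] by (auto simp: inj_def indicator_def pmf_eq_0_set_pmf)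
  then show ?thesis
    by (simp add: pmf_bind measure_pmf_single)
qed

lemma transition_function_closed:
  "transition_function S p \<Longrightarrow> 0 \<le> t \<Longrightarrow> x \<in> S \<Longrightarrow> y \<in> set_pmf (p t x) \<Longrightarrow> y \<in> S"
  unfolding transition_function_def by blast

lemma map_path_pmf:
  assumes "transition_function S p"
    and "\<And>t x. 0 \<le> t \<Longrightarrow> x \<in> S \<Longrightarrow> map_pmf g (p t x) = p' t (g x)"
    and "x \<in> S" "sorted (s # ts)"
  shows "map_pmf (map g) (path_pmf p s x ts) = path_pmf p' s (g x) ts"
  using assms(3,4)
proof (induction ts arbitrary: s x)
  case (Cons t ts)
  have "map_pmf (map g) (path_pmf p s x (t # ts))
      = bind_pmf (p (t - s) x) (\<lambda>y. map_pmf (Cons (g y)) (map_pmf (map g) (path_pmf p t y ts)))"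
    by (simp add: map_bind_pmf map_pmf_comp)
  also have "\<dots> = bind_pmf (p (t - s) x) (\<lambda>y. map_pmf (Cons (g y)) (path_pmf p' t (g y) ts))"
  proof (rule bind_pmf_cong[OF refl])
    fix y assume "y \<in> set_pmf (p (t - s) x)"
    then have "y \<in> S"
      using Cons.prems transition_function_closed[OF assms(1), of "t - s" x y] by simp
    then show "map_pmf (Cons (g y)) (map_pmf (map g) (path_pmf p t y ts)) = map_pmf (Cons (g y)) (path_pmf p' t (g y) ts)"
      using Cons.prems by (simp add: Cons.IH)
  qed
  also have "\<dots> = bind_pmf (map_pmf g (p (t - s) x)) (\<lambda>y. map_pmf (Cons y) (path_pmf p' t y ts))"
    by (simp add: bind_map_pmf)
  finally show ?case
    using Cons.prems by (simp add: assms(2))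
qed simp

lemma all_le_Suc_split: "(\<forall>l\<le>k. P l) \<longleftrightarrow> P 0 \<and> (\<forall>l<k. P (Suc l))"
  using All_less_Suc2[of k P] by (simp add: less_Suc_eq_le)

lemma path_pmf_cong:
  assumes "transition_function S p" "\<And>t x. 0 \<le> t \<Longrightarrow> x \<in> S \<Longrightarrow> p t x = p' t x" "x \<in> S" "sorted (s # ts)"
  shows "path_pmf p s x ts = path_pmf p' s x ts"
  using map_path_pmf[of S p id p' x s ts] assms by (simp add: map_pmf_id)

text \<open>Stated as an equality of measures on lists, so that images and integrals transfer by
  rewriting, and chains on different sample spaces can be compared through the common data
  \<open>\<mu>\<close> and \<open>p\<close>.\<close>

definition has_fdds :: "'w measure \<Rightarrow> (real \<Rightarrow> 'w \<Rightarrow> 's) \<Rightarrow> 's pmf \<Rightarrow> (real \<Rightarrow> 's \<Rightarrow> 's pmf) \<Rightarrow> bool" where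
  "has_fdds M X \<mu> p \<longleftrightarrow> (\<forall>ts. sorted (0 # ts) \<longrightarrow>
     distr M (count_space UNIV) (\<lambda>\<omega>. map (\<lambda>t. X t \<omega>) ts) = measure_pmf (bind_pmf \<mu> (\<lambda>x. path_pmf p 0 x ts)))"

lemma measurable_count_space_UNIV:
  assumes "f \<in> M \<rightarrow>\<^sub>M count_space C"
  shows "f \<in> M \<rightarrow>\<^sub>M count_space UNIV"
  using measurable_compose[OF assms, of "\<lambda>x. x" "count_space UNIV"] by simp

text \<open>Countability of \<open>S\<close> makes finite products of discrete sigma-algebras
  discrete.\<close>

lemma measurable_map_process:
  assumes "countable S" "\<And>t. t \<in> set ts \<Longrightarrow> X t \<in> M \<rightarrow>\<^sub>M count_space S"
  shows "(\<lambda>\<omega>. map (\<lambda>t. X t \<omega>) ts) \<in> M \<rightarrow>\<^sub>M count_space UNIV"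
proof -
  have "(\<lambda>\<omega>. map (\<lambda>t. X t \<omega>) ts) \<in> M \<rightarrow>\<^sub>M count_space (lists S)"
    using assms(2)
  proof (induction ts)
    case (Cons t ts)
    have "(\<lambda>\<omega>. (X t \<omega>, map (\<lambda>t. X t \<omega>) ts)) \<in> M \<rightarrow>\<^sub>M count_space S \<Otimes>\<^sub>M count_space (lists S)"
      using Cons by (intro measurable_Pair) auto
    also have "count_space S \<Otimes>\<^sub>M count_space (lists S) = count_space (S \<times> lists S)"
      using assms(1) by (intro pair_measure_countable) auto
    finally have "(\<lambda>\<omega>. (X t \<omega>, map (\<lambda>t. X t \<omega>) ts)) \<in> M \<rightarrow>\<^sub>M count_space (S \<times> lists S)" .
    then have "(\<lambda>\<omega>. (\<lambda>(a, b). a # b) (X t \<omega>, map (\<lambda>t. X t \<omega>) ts)) \<in> M \<rightarrow>\<^sub>M count_space (lists S)"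
      by (rule measurable_compose) auto
    then show ?case by simp
  qed simp
  then show ?thesis
    by (rule measurable_count_space_UNIV)
qed

lemma distr_pmf_exists:
  assumes "prob_space M" "f \<in> M \<rightarrow>\<^sub>M count_space C" "countable C"
  obtains \<nu> where "distr M (count_space UNIV) f = measure_pmf \<nu>" "set_pmf \<nu> \<subseteq> C"
proof -
  interpret prob_space M by fact
  have f: "f \<in> M \<rightarrow>\<^sub>M count_space UNIV"
    using assms(2) by (rule measurable_count_space_UNIV)
  have C: "AE x in distr M (count_space UNIV) f. x \<in> C"
    using measurable_space[OF assms(2)] f by (subst AE_distr_iff) auto
  interpret D: prob_space "distr M (count_space UNIV) f"
    using f by (rule prob_space_distr)
  have "AE x in distr M (count_space UNIV) f. measure (distr M (count_space UNIV) f) {x} \<noteq> 0"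
    using C assms(3) by (subst D.AE_support_countable) auto
  then have inv: "measure_pmf (Abs_pmf (distr M (count_space UNIV) f)) = distr M (count_space UNIV) f"
    by (intro Abs_pmf_inverse) (auto simp: D.prob_space_axioms)
  have "AE x in measure_pmf (Abs_pmf (distr M (count_space UNIV) f)). x \<in> C"
    unfolding inv by (rule C)
  then show ?thesis
    using inv by (intro that[of "Abs_pmf (distr M (count_space UNIV) f)"]) (auto simp: AE_measure_pmf_iff)
qed

text \<open>Agreement of the point masses on \<open>C\<close> is enough: the distribution lives on
  \<open>C\<close>, so it is bounded by \<open>\<nu>\<close> on every set, and equal masses force
  equality.\<close>

lemma measure_pmf_eqI_distr:
  assumes "prob_space M" "f \<in> M \<rightarrow>\<^sub>M count_space UNIV" "countable C" "\<And>\<omega>. \<omega> \<in> space M \<Longrightarrow> f \<omega> \<in> C"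
    and "\<And>a. a \<in> C \<Longrightarrow> measure M {\<omega> \<in> space M. f \<omega> = a} = pmf \<nu> a"
  shows "distr M (count_space UNIV) f = measure_pmf \<nu>"
proof -
  have "f \<in> M \<rightarrow>\<^sub>M count_space C"
    using assms(2,4) by (auto simp: measurable_def)
  from distr_pmf_exists[OF assms(1) this assms(3)] obtain \<nu>' where \<nu>':
    "distr M (count_space UNIV) f = measure_pmf \<nu>'" "set_pmf \<nu>' \<subseteq> C" .
  have eq: "pmf \<nu>' a = pmf \<nu> a" if "a \<in> C" for a
  proof -
    have "pmf \<nu>' a = measure (distr M (count_space UNIV) f) {a}"
      by (simp add: \<nu>'(1) measure_pmf_single)
    also have "\<dots> = measure M {\<omega> \<in> space M. f \<omega> = a}"
      using assms(2) by (subst measure_distr) (auto intro!: arg_cong[where f = "measure M"])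
    finally show ?thesis using assms(5)[OF that] by simp
  qed
  have "measure_pmf.prob \<nu>' A \<le> measure_pmf.prob \<nu> A" for A
  proof -
    have "measure_pmf.prob \<nu>' A = measure_pmf.prob \<nu>' (A \<inter> C)"
      using \<nu>'(2) by (intro measure_pmf.finite_measure_eq_AE) (auto simp: AE_measure_pmf_iff)
    also have "\<dots> = measure_pmf.prob \<nu> (A \<inter> C)"
      unfolding measure_pmf_conv_infsetsum by (intro infsetsum_cong) (auto simp: eq)
    also have "\<dots> \<le> measure_pmf.prob \<nu> A"
      by (intro measure_pmf.finite_measure_mono) auto
    finally show ?thesis .
  qed
  then have "\<nu>' = \<nu>"
    by (rule pmf_eqI_measure_le)
  then show ?thesis
    using \<nu>'(1) by simp
qed

lemma pmf_path_pmf: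
  "length xs = length ts \<Longrightarrow> pmf (path_pmf p s x ts) xs =
     (\<Prod>l<length ts. pmf (p (ts ! l - (s # ts) ! l) ((x # xs) ! l)) (xs ! l))"
proof (induction ts arbitrary: s x xs)
  case (Cons t ts)
  then obtain y ys where xs: "xs = y # ys" "length ys = length ts"
    by (cases xs) auto
  show ?case
    using Cons.IH[OF xs(2), of t y]
    by (simp add: xs pmf_bind_map_Cons prod.lessThan_Suc_shift del: prod.lessThan_Suc)
qed simp

lemma has_fdds_if_markov_chain:
  assumes "markov_chain S Q M X" "countable S"
  obtains p \<mu> where "transition_function S p" "has_generator S p Q" "has_fdds M X \<mu> p"
    "distr M (count_space UNIV) (X 0) = measure_pmf \<mu>" "set_pmf \<mu> \<subseteq> S"
proof -
  from assms(1) obtain p where p: "transition_function S p" "has_generator S p Q"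
    and fdd: "\<And>(k::nat) (t::nat \<Rightarrow> real) x. 0 \<le> t 0 \<Longrightarrow> (\<forall>l<k. t l \<le> t (Suc l)) \<Longrightarrow> (\<forall>l\<le>k. x l \<in> S) \<Longrightarrow>
           measure M {\<omega>\<in>space M. \<forall>l\<le>k. X (t l) \<omega> = x l} =
             measure M {\<omega>\<in>space M. X (t 0) \<omega> = x 0} *
             (\<Prod>l<k. pmf (p (t (Suc l) - t l) (x l)) (x (Suc l)))"
    unfolding markov_chain_def by blast
  have M: "prob_space M" and X: "\<And>t. 0 \<le> t \<Longrightarrow> X t \<in> M \<rightarrow>\<^sub>M count_space S"
    using assms(1) by (auto simp: markov_chain_def)
  obtain \<mu> where \<mu>: "distr M (count_space UNIV) (X 0) = measure_pmf \<mu>" "set_pmf \<mu> \<subseteq> S"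
    using distr_pmf_exists[OF M X[of 0] assms(2)] by auto
  have X0: "X 0 \<in> M \<rightarrow>\<^sub>M count_space UNIV"
    using X[of 0] by (intro measurable_count_space_UNIV) auto
  have \<mu>_pmf: "measure M {\<omega>\<in>space M. X 0 \<omega> = a} = pmf \<mu> a" for a
  proof -
    have "pmf \<mu> a = measure (distr M (count_space UNIV) (X 0)) {a}"
      by (simp add: \<mu>(1) measure_pmf_single)
    also have "\<dots> = measure M {\<omega>\<in>space M. X 0 \<omega> = a}"
      using X0 by (subst measure_distr) (auto intro!: arg_cong[where f = "measure M"])
    finally show ?thesis by simp
  qed
  have "has_fdds M X \<mu> p"
    unfolding has_fdds_def
  proof (intro allI impI)
    fix ts :: "real list" assume ts: "sorted (0 # ts)"
    \<comment> \<open>The defining product formula starts from the law at the first observed time.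
      Time 0 is prepended to make this law \<open>\<mu>\<close>, and is removed at the end with
      \<open>tl\<close>.\<close>
    let ?\<nu> = "bind_pmf \<mu> (\<lambda>x. map_pmf (Cons x) (path_pmf p 0 x ts))"
    let ?C = "{xs \<in> lists S. length xs = Suc (length ts)}"
    have meas: "(\<lambda>\<omega>. map (\<lambda>t. X t \<omega>) us) \<in> M \<rightarrow>\<^sub>M count_space UNIV" if "set us \<subseteq> set (0 # ts)" for us
      using that ts by (intro measurable_map_process[OF assms(2)] X) auto
    have "distr M (count_space UNIV) (\<lambda>\<omega>. map (\<lambda>t. X t \<omega>) (0 # ts)) = measure_pmf ?\<nu>"
    proof (rule measure_pmf_eqI_distr[OF M, where C = ?C])
      show "(\<lambda>\<omega>. map (\<lambda>t. X t \<omega>) (0 # ts)) \<in> M \<rightarrow>\<^sub>M count_space UNIV"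
        by (rule meas) simp
      show "countable ?C"
        using assms(2) by (auto intro: countable_subset[of _ "lists S"])
      show "map (\<lambda>t. X t \<omega>) (0 # ts) \<in> ?C" if "\<omega> \<in> space M" for \<omega>
        using that ts measurable_space[OF X] by auto
      fix a assume "a \<in> ?C"
      then obtain x xs where a: "a = x # xs" "x \<in> S" "set xs \<subseteq> S" "length xs = length ts"
        by (cases a) auto
      have "measure M {\<omega>\<in>space M. \<forall>l\<le>length ts. X ((0 # ts) ! l) \<omega> = a ! l}
          = pmf \<mu> x * (\<Prod>l<length ts. pmf (p (ts ! l - (0 # ts) ! l) (a ! l)) (xs ! l))"
      proof -
        have "\<forall>l<length ts. (0 # ts) ! l \<le> (0 # ts) ! Suc l"
          using sorted_nth_mono[OF ts, of l "Suc l" for l] by simp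
        moreover have "\<forall>l\<le>length ts. a ! l \<in> S"
          using a by (auto simp: all_le_Suc_split)
        ultimately show ?thesis
          using fdd[of "(!) (0 # ts)" "length ts" "(!) a"] by (simp add: a \<mu>_pmf)
      qed
      moreover have "{\<omega>\<in>space M. \<forall>l\<le>length ts. X ((0 # ts) ! l) \<omega> = a ! l}
          = {\<omega>\<in>space M. map (\<lambda>t. X t \<omega>) (0 # ts) = a}"
        by (simp add: a all_le_Suc_split list_eq_iff_nth_eq All_less_Suc2)
      ultimately show "measure M {\<omega>\<in>space M. map (\<lambda>t. X t \<omega>) (0 # ts) = a} = pmf ?\<nu> a"
        by (simp add: a pmf_bind_map_Cons pmf_path_pmf)
    qed
    then have "distr (distr M (count_space UNIV) (\<lambda>\<omega>. map (\<lambda>t. X t \<omega>) (0 # ts))) (count_space UNIV) tl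
        = measure_pmf (map_pmf tl ?\<nu>)"
      by (simp add: map_pmf_rep_eq)
    also have "distr (distr M (count_space UNIV) (\<lambda>\<omega>. map (\<lambda>t. X t \<omega>) (0 # ts))) (count_space UNIV) tl
        = distr M (count_space UNIV) (\<lambda>\<omega>. map (\<lambda>t. X t \<omega>) ts)"
      using meas[of "0 # ts"] by (subst distr_distr) (auto simp: comp_def)
    also have "map_pmf tl ?\<nu> = bind_pmf \<mu> (\<lambda>x. path_pmf p 0 x ts)"
      by (simp add: map_bind_pmf map_pmf_comp)
    finally show "distr M (count_space UNIV) (\<lambda>\<omega>. map (\<lambda>t. X t \<omega>) ts)
        = measure_pmf (bind_pmf \<mu> (\<lambda>x. path_pmf p 0 x ts))" .
  qed
  then show thesis
    by (rule that[OF p _ \<mu>])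
qed

lemma measure_has_fdds:
  assumes "has_fdds M X \<mu> p" "countable S" "\<And>t. 0 \<le> t \<Longrightarrow> X t \<in> M \<rightarrow>\<^sub>M count_space S" "sorted (0 # ts)"
  shows "measure M {\<omega>\<in>space M. map (\<lambda>t. X t \<omega>) ts \<in> A} = measure_pmf.prob (bind_pmf \<mu> (\<lambda>x. path_pmf p 0 x ts)) A"
proof -
  have "measure_pmf.prob (bind_pmf \<mu> (\<lambda>x. path_pmf p 0 x ts)) A
      = measure (distr M (count_space UNIV) (\<lambda>\<omega>. map (\<lambda>t. X t \<omega>) ts)) A"
    using assms(1,4) by (simp add: has_fdds_def)
  also have "\<dots> = measure M {\<omega>\<in>space M. map (\<lambda>t. X t \<omega>) ts \<in> A}"
    using assms(3,4) by (subst measure_distr[OF measurable_map_process[OF assms(2)]])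
      (auto intro!: arg_cong[where f = "measure M"])
  finally show ?thesis by simp
qed

lemma markov_chain_if_has_fdds:
  assumes "prob_space M" "countable S" and X: "\<And>t. 0 \<le> t \<Longrightarrow> X t \<in> M \<rightarrow>\<^sub>M count_space S"
    and "\<And>\<omega> t. \<omega> \<in> space M \<Longrightarrow> 0 \<le> t \<Longrightarrow> \<forall>\<^sub>F s in at_right t. X s \<omega> = X t \<omega>"
    and p: "transition_function S p" "has_generator S p Q" and fdds: "has_fdds M X \<mu> p"
  shows "markov_chain S Q M X"
proof -
  have "measure M {\<omega>\<in>space M. \<forall>l\<le>k. X (t l) \<omega> = x l} =
      measure M {\<omega>\<in>space M. X (t 0) \<omega> = x 0} * (\<Prod>l<k. pmf (p (t (Suc l) - t l) (x l)) (x (Suc l)))"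
    if t: "0 \<le> t 0" "\<forall>l<k. t l \<le> t (Suc l)" for k :: nat and t :: "nat \<Rightarrow> real" and x
  proof -
    let ?ts = "map (\<lambda>l. t (Suc l)) [0..<k]" and ?xs = "map (\<lambda>l. x (Suc l)) [0..<k]"
    have mono: "t i \<le> t j" if "i \<le> j" "j \<le> k" for i j
      using that
    proof (induction j rule: dec_induct)
      case (step j)
      then have "t i \<le> t j" "t j \<le> t (Suc j)"
        using t(2) by auto
      then show ?case by simp
    qed simp
    have ts_eq: "t 0 # ?ts = map t [0..<Suc k]"
      by (simp add: upt_conv_Cons map_Suc_upt[symmetric] del: upt_Suc)
    have "sorted (map t [0..<Suc k])"
      by (auto simp: sorted_iff_nth_mono intro!: mono simp del: upt_Suc)
    then have sorted: "sorted (0 # t 0 # ?ts)"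
      unfolding ts_eq[symmetric] using t(1) by auto
    have eq: "measure M {\<omega>\<in>space M. map (\<lambda>t. X t \<omega>) us = as} = pmf (bind_pmf \<mu> (\<lambda>x. path_pmf p 0 x us)) as"
      if "sorted (0 # us)" for us as
      using measure_has_fdds[OF fdds assms(2) X that, of "{as}"] by (simp add: measure_pmf_single)
    \<comment> \<open>The first observed time may be positive; the law of the chain there supplies
      the leading factor of the product formula.\<close>
    have joint: "bind_pmf \<mu> (\<lambda>x. path_pmf p 0 x (t 0 # us))
        = bind_pmf (bind_pmf \<mu> (p (t 0))) (\<lambda>y. map_pmf (Cons y) (path_pmf p (t 0) y us))" for us
      by (simp add: bind_assoc_pmf)
    have "{\<omega>\<in>space M. \<forall>l\<le>k. X (t l) \<omega> = x l} = {\<omega>\<in>space M. map (\<lambda>t. X t \<omega>) (t 0 # ?ts) = x 0 # ?xs}"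
      by (simp add: all_le_Suc_split list_eq_iff_nth_eq All_less_Suc2)
    also have "measure M \<dots> = pmf (bind_pmf \<mu> (p (t 0))) (x 0) * pmf (path_pmf p (t 0) (x 0) ?ts) ?xs"
      using eq[OF sorted] by (simp only: joint pmf_bind_map_Cons)
    also have "pmf (path_pmf p (t 0) (x 0) ?ts) ?xs = (\<Prod>l<k. pmf (p (t (Suc l) - t l) (x l)) (x (Suc l)))"
      by (subst pmf_path_pmf) (auto intro!: prod.cong simp: nth_Cons split: nat.split)
    also have "pmf (bind_pmf \<mu> (p (t 0))) (x 0) = measure M {\<omega>\<in>space M. X (t 0) \<omega> = x 0}"
      using eq[of "[t 0]" "[x 0]"] t(1) pmf_bind_map_Cons[of "bind_pmf \<mu> (p (t 0))" "\<lambda>_. return_pmf []" "x 0" "[]"]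
      by (simp add: bind_assoc_pmf)
    finally show ?thesis .
  qed
  with assms show ?thesis
    unfolding markov_chain_def by blast
qed

text \<open>Cylinders over finitely many times generate the product sigma-algebra and are stable
  under intersection, so a law on paths is determined by its finite-dimensional
  distributions.\<close>

lemma process_law_eqI:
  assumes M: "prob_space M" and N: "prob_space N" and "countable S"
    and X: "\<And>t. 0 \<le> t \<Longrightarrow> X t \<in> M \<rightarrow>\<^sub>M count_space S" and Y: "\<And>t. 0 \<le> t \<Longrightarrow> Y t \<in> N \<rightarrow>\<^sub>M count_space S"
    and "has_fdds M X \<mu> p" "has_fdds N Y \<mu> p"
  shows "process_law S M X = process_law S N Y"
  unfolding process_law_def
proof (rule measure_eqI_PiM_infinite[where I = "{0..}" and M = "\<lambda>_. count_space S"])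
  have mX: "(\<lambda>\<omega>. \<lambda>t\<in>{0..}. X t \<omega>) \<in> M \<rightarrow>\<^sub>M (\<Pi>\<^sub>M t\<in>{0..}. count_space S)"
    by (rule measurable_restrict) (auto intro: X)
  have mY: "(\<lambda>\<omega>. \<lambda>t\<in>{0..}. Y t \<omega>) \<in> N \<rightarrow>\<^sub>M (\<Pi>\<^sub>M t\<in>{0..}. count_space S)"
    by (rule measurable_restrict) (auto intro: Y)
  interpret M: prob_space M by fact
  interpret N: prob_space N by fact
  interpret D: prob_space "distr M (\<Pi>\<^sub>M t\<in>{0..}. count_space S) (\<lambda>\<omega>. \<lambda>t\<in>{0..}. X t \<omega>)"
    using mX by (rule M.prob_space_distr)
  show "finite_measure (distr M (\<Pi>\<^sub>M t\<in>{0..}. count_space S) (\<lambda>\<omega>. \<lambda>t\<in>{0..}. X t \<omega>))"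
    by unfold_locales
  fix A and J :: "real set"
  assume J: "finite J" "J \<subseteq> {0..}" and A: "\<And>i. i \<in> J \<Longrightarrow> A i \<in> sets (count_space S)"
  let ?ts = "sorted_list_of_set J"
  let ?E = "prod_emb {0..} (\<lambda>_. count_space S) J (Pi\<^sub>E J A)"
  have ts: "sorted (0 # ?ts)" and set_ts: "set ?ts = J"
    using J by auto
  have E: "?E \<in> sets (\<Pi>\<^sub>M t\<in>{0..}. count_space S)"
    using J A by (intro sets_PiM_I) auto
  \<comment> \<open>The sample space has a type variable of its own, so that the fact applies both
    to \<open>M\<close> and to \<open>N\<close>.\<close>
  have *: "emeasure (distr K (\<Pi>\<^sub>M t\<in>{0..}. count_space S) (\<lambda>\<omega>. \<lambda>t\<in>{0..}. Z t \<omega>)) ?E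
      = ennreal (measure_pmf.prob (bind_pmf \<mu> (\<lambda>x. path_pmf p 0 x ?ts)) {xs. list_all2 (\<lambda>t x. x \<in> A t) ?ts xs})"
    if K: "prob_space K" and Z: "\<And>t. 0 \<le> t \<Longrightarrow> Z t \<in> K \<rightarrow>\<^sub>M count_space S" and fdds: "has_fdds K Z \<mu> p"
      and mZ: "(\<lambda>\<omega>. \<lambda>t\<in>{0..}. Z t \<omega>) \<in> K \<rightarrow>\<^sub>M (\<Pi>\<^sub>M t\<in>{0..}. count_space S)"
    for K :: "'x measure" and Z
  proof -
    interpret K: prob_space K by fact
    have "emeasure (distr K (\<Pi>\<^sub>M t\<in>{0..}. count_space S) (\<lambda>\<omega>. \<lambda>t\<in>{0..}. Z t \<omega>)) ?E
        = emeasure K ((\<lambda>\<omega>. \<lambda>t\<in>{0..}. Z t \<omega>) -` ?E \<inter> space K)"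
      using mZ E by (rule emeasure_distr)
    also have "(\<lambda>\<omega>. \<lambda>t\<in>{0..}. Z t \<omega>) -` ?E \<inter> space K
        = {\<omega> \<in> space K. map (\<lambda>t. Z t \<omega>) ?ts \<in> {xs. list_all2 (\<lambda>t x. x \<in> A t) ?ts xs}}"
      (is "?L = ?R")
    proof (rule set_eqI)
      fix \<omega>
      have "\<omega> \<in> ?L \<longleftrightarrow> \<omega> \<in> space K \<and> (\<forall>t\<in>J. Z t \<omega> \<in> A t)"
        using J measurable_space[OF Z, of _ \<omega>] by (auto simp: prod_emb_iff PiE_iff)
      also have "\<dots> \<longleftrightarrow> \<omega> \<in> ?R"
        using all_set_conv_all_nth[of ?ts "\<lambda>t. Z t \<omega> \<in> A t"] unfolding set_ts
        by (simp add: list_all2_conv_all_nth)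
      finally show "\<omega> \<in> ?L \<longleftrightarrow> \<omega> \<in> ?R" .
    qed
    finally show ?thesis
      using measure_has_fdds[OF fdds assms(3) Z ts, of "{xs. list_all2 (\<lambda>t x. x \<in> A t) ?ts xs}"]
      unfolding K.emeasure_eq_measure by (rule trans[OF _ arg_cong[where f = ennreal]])
  qed
  show "emeasure (distr M (\<Pi>\<^sub>M t\<in>{0..}. count_space S) (\<lambda>\<omega>. \<lambda>t\<in>{0..}. X t \<omega>)) ?E
      = emeasure (distr N (\<Pi>\<^sub>M t\<in>{0..}. count_space S) (\<lambda>\<omega>. \<lambda>t\<in>{0..}. Y t \<omega>)) ?E"
    using *[OF M X assms(6) mX] *[OF N Y assms(7) mY] by simp
qed simp_all

text \<open>A function of a Markov chain is again Markov if it intertwines the two semigroups; the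
  marginals of the coupled chain are obtained in this way.\<close>

lemma has_fdds_map:
  assumes "has_fdds M X \<mu> p" "countable S" "\<And>t. 0 \<le> t \<Longrightarrow> X t \<in> M \<rightarrow>\<^sub>M count_space S" "set_pmf \<mu> \<subseteq> S"
    and p: "transition_function S p" "\<And>t x. 0 \<le> t \<Longrightarrow> x \<in> S \<Longrightarrow> map_pmf g (p t x) = p' t (g x)"
  shows "has_fdds M (\<lambda>t \<omega>. g (X t \<omega>)) (map_pmf g \<mu>) p'"
  unfolding has_fdds_def
proof (intro allI impI)
  fix ts :: "real list" assume ts: "sorted (0 # ts)"
  have m: "(\<lambda>\<omega>. map (\<lambda>t. X t \<omega>) ts) \<in> M \<rightarrow>\<^sub>M count_space UNIV"
    using ts by (intro measurable_map_process[OF assms(2)] assms(3)) auto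
  have "distr M (count_space UNIV) (\<lambda>\<omega>. map (\<lambda>t. g (X t \<omega>)) ts)
      = distr (distr M (count_space UNIV) (\<lambda>\<omega>. map (\<lambda>t. X t \<omega>) ts)) (count_space UNIV) (map g)"
    using m by (subst distr_distr) (auto simp: comp_def)
  also have "\<dots> = measure_pmf (map_pmf (map g) (bind_pmf \<mu> (\<lambda>x. path_pmf p 0 x ts)))"
    using assms(1) ts by (simp add: has_fdds_def map_pmf_rep_eq)
  also have "map_pmf (map g) (bind_pmf \<mu> (\<lambda>x. path_pmf p 0 x ts)) = bind_pmf \<mu> (\<lambda>x. path_pmf p' 0 (g x) ts)"
    unfolding map_bind_pmf
    by (rule bind_pmf_cong[OF refl], rule map_path_pmf[OF p]) (use ts assms(4) in auto)
  finally show "distr M (count_space UNIV) (\<lambda>\<omega>. map (\<lambda>t. g (X t \<omega>)) ts)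
      = measure_pmf (bind_pmf (map_pmf g \<mu>) (\<lambda>x. path_pmf p' 0 x ts))"
    by (simp add: bind_map_pmf)
qed


section \<open>Existence of right-continuous chains\<close>

text \<open>The variant with functions in place of lists matches product spaces: values at unlisted
  times are \<open>undefined\<close>, as for extensional functions, so forgetting times is literally
  \<open>restrict\<close>.\<close>

primrec path_fun_pmf :: "(real \<Rightarrow> 's \<Rightarrow> 's pmf) \<Rightarrow> real \<Rightarrow> 's \<Rightarrow> real list \<Rightarrow> (real \<Rightarrow> 's) pmf" where
  "path_fun_pmf p s x [] = return_pmf (\<lambda>_. undefined)"
| "path_fun_pmf p s x (t # ts) = bind_pmf (p (t - s) x) (\<lambda>y. map_pmf (\<lambda>f. f(t := y)) (path_fun_pmf p t y ts))"

lemma transition_function_add: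
  "transition_function S p \<Longrightarrow> 0 \<le> s \<Longrightarrow> 0 \<le> t \<Longrightarrow> x \<in> S \<Longrightarrow> p (s + t) x = bind_pmf (p s x) (p t)"
  unfolding transition_function_def by blast

text \<open>Chapman-Kolmogorov: a time whose value is not recorded can be left out.\<close>

lemma path_fun_pmf_skip:
  assumes "transition_function S p" "x \<in> S" "sorted (s # t # ts)"
  shows "bind_pmf (p (t - s) x) (\<lambda>y. path_fun_pmf p t y ts) = path_fun_pmf p s x ts"
proof (cases ts)
  case (Cons u us)
  then have "p (u - s) x = bind_pmf (p (t - s) x) (p (u - t))"
    using transition_function_add[OF assms(1), of "t - s" "u - t" x] assms(2,3) by simp
  then show ?thesis
    by (simp add: Cons bind_assoc_pmf)
qed simp

text \<open>This is the consistency condition of the extension theorem. A removed time is absorbed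
  into the next increment, or simply dropped if it is the last.\<close>

lemma restrict_path_fun_pmf:
  assumes p: "transition_function S p" and "x \<in> S" "sorted (s # ts)"
  shows "map_pmf (\<lambda>f. restrict f H) (path_fun_pmf p s x ts) = path_fun_pmf p s x (filter (\<lambda>t. t \<in> H) ts)"
  using assms(2,3)
proof (induction ts arbitrary: s x)
  case Nil
  then show ?case by (simp add: restrict_def)
next
  case (Cons t ts)
  have IH: "map_pmf (\<lambda>f. restrict f H) (path_fun_pmf p t y ts) = path_fun_pmf p t y (filter (\<lambda>t. t \<in> H) ts)"
    if "y \<in> set_pmf (p (t - s) x)" for y
    by (intro Cons.IH) (use Cons.prems transition_function_closed[OF p _ _ that] in auto)
  show ?case
  proof (cases "t \<in> H")
    case True
    have upd: "restrict (f(t := y)) H = (restrict f H)(t := y)" for f :: "real \<Rightarrow> 'a" and y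
      using True by (auto simp: fun_eq_iff)
    have "map_pmf (\<lambda>f. restrict f H) (path_fun_pmf p s x (t # ts)) = bind_pmf (p (t - s) x)
        (\<lambda>y. map_pmf (\<lambda>f. f(t := y)) (map_pmf (\<lambda>f. restrict f H) (path_fun_pmf p t y ts)))"
      by (simp only: path_fun_pmf.simps map_bind_pmf map_pmf_comp upd)
    also have "\<dots> = path_fun_pmf p s x (filter (\<lambda>t. t \<in> H) (t # ts))"
      using True by (simp add: IH cong: bind_pmf_cong)
    finally show ?thesis .
  next
    case False
    have upd: "restrict (f(t := y)) H = restrict f H" for f :: "real \<Rightarrow> 'a" and y
      using False by (auto simp: fun_eq_iff)
    have "map_pmf (\<lambda>f. restrict f H) (path_fun_pmf p s x (t # ts))
        = bind_pmf (p (t - s) x) (\<lambda>y. map_pmf (\<lambda>f. restrict f H) (path_fun_pmf p t y ts))"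
      by (simp only: path_fun_pmf.simps map_bind_pmf map_pmf_comp upd)
    also have "\<dots> = bind_pmf (p (t - s) x) (\<lambda>y. path_fun_pmf p t y (filter (\<lambda>t. t \<in> H) ts))"
      by (simp add: IH cong: bind_pmf_cong)
    also have "\<dots> = path_fun_pmf p s x (filter (\<lambda>t. t \<in> H) (t # ts))"
      unfolding filter.simps if_not_P[OF False]
      using Cons.prems by (intro path_fun_pmf_skip[OF p]) (auto intro: sorted_filter[of id, simplified])
    finally show ?thesis .
  qed
qed

text \<open>\<open>has_fdds\<close> admits repeated times, whereas the extension theorem indexes by
  sets. A repetition has increment 0 and therefore copies the previous value.\<close>

lemma map_path_fun_pmf:
  assumes p: "transition_function S p" and "x \<in> S" "sorted (s # ts)"
  shows "map_pmf (\<lambda>f. map f ts) (path_fun_pmf p s x (remdups_adj ts)) = path_pmf p s x ts"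
  using assms(2,3)
proof (induction ts arbitrary: s x rule: remdups_adj.induct)
  case (2 t)
  then show ?case by (simp add: map_bind_pmf)
next
  case (3 t u ts)
  show ?case
  proof (cases "t = u")
    case True
    have step: "path_pmf p t y (t # ts) = map_pmf (Cons y) (path_pmf p t y ts)" if "y \<in> set_pmf (p (t - s) x)" for y
      using transition_function_closed[OF p _ _ that] p 3(3,4)
      by (simp add: transition_function_def bind_return_pmf)
    have "map_pmf (\<lambda>f. map f (t # t # ts)) (path_fun_pmf p s x (remdups_adj (t # ts)))
        = map_pmf (\<lambda>zs. hd zs # zs) (map_pmf (\<lambda>f. map f (t # ts)) (path_fun_pmf p s x (remdups_adj (t # ts))))"
      by (simp add: map_pmf_comp)
    also have "\<dots> = map_pmf (\<lambda>zs. hd zs # zs) (path_pmf p s x (t # ts))"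
      using 3(1)[OF True] 3(3,4) True by simp
    also have "\<dots> = bind_pmf (p (t - s) x) (\<lambda>y. map_pmf (Cons y) (map_pmf (Cons y) (path_pmf p t y ts)))"
      by (simp add: map_bind_pmf map_pmf_comp)
    also have "\<dots> = path_pmf p s x (t # t # ts)"
      unfolding path_pmf.simps(2)[of p s x t "t # ts"]
      by (rule bind_pmf_cong[OF refl], simp only: step)
    finally show ?thesis using True by simp
  next
    case False
    then have notin: "t \<notin> set (u # ts)"
      using 3(4) by auto
    have "map_pmf (\<lambda>f. map f (t # u # ts)) (path_fun_pmf p s x (remdups_adj (t # u # ts)))
        = bind_pmf (p (t - s) x) (\<lambda>y. map_pmf (Cons y) (map_pmf (\<lambda>f. map f (u # ts))
            (path_fun_pmf p t y (remdups_adj (u # ts)))))"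
    proof -
      have *: "map (f(t := y)) (t # u # ts) = y # map f (u # ts)" for f :: "real \<Rightarrow> 'a" and y
        using notin by auto
      have "remdups_adj (t # u # ts) = t # remdups_adj (u # ts)"
        using False by simp
      then show ?thesis
        by (simp only: path_fun_pmf.simps map_bind_pmf map_pmf_comp *)
    qed
    also have "\<dots> = path_pmf p s x (t # u # ts)"
      unfolding path_pmf.simps(2)[of p s x t "u # ts"]
    proof (rule bind_pmf_cong[OF refl])
      fix y assume "y \<in> set_pmf (p (t - s) x)"
      then have "y \<in> S"
        using transition_function_closed[OF p, of "t - s" x y] 3(3,4) by simp
      then show "map_pmf (Cons y) (map_pmf (\<lambda>f. map f (u # ts)) (path_fun_pmf p t y (remdups_adj (u # ts))))
          = map_pmf (Cons y) (path_pmf p t y (u # ts))"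
        using 3(2)[OF False, of y t] 3(4) by simp
    qed
    finally show ?thesis .
  qed
qed simp

lemma sorted_list_of_set_remdups_adj:
  fixes ts :: "'t::linorder list"
  assumes "sorted ts"
  shows "sorted_list_of_set (set ts) = remdups_adj ts"
proof -
  have "sorted_wrt (<) (remdups_adj ts)"
    using assms by (induction ts rule: remdups_adj.induct) auto
  then show ?thesis
    using sorted_list_of_set.idem_if_sorted_distinct[of "remdups_adj ts"] by (simp add: strict_sorted_iff)
qed

lemma sorted_list_of_set_filter:
  fixes H :: "'t::linorder set"
  assumes "finite H" "J \<subseteq> H"
  shows "filter (\<lambda>t. t \<in> J) (sorted_list_of_set H) = sorted_list_of_set J"
proof -
  have "set (filter (\<lambda>t. t \<in> J) (sorted_list_of_set H)) = J"
    using assms by auto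
  moreover have "sorted_list_of_set (set (filter (\<lambda>t. t \<in> J) (sorted_list_of_set H)))
      = filter (\<lambda>t. t \<in> J) (sorted_list_of_set H)"
    by (intro sorted_list_of_set.idem_if_sorted_distinct sorted_filter[of id, simplified] distinct_filter) auto
  ultimately show ?thesis by simp
qed

text \<open>Kolmogorov's extension theorem; states are encoded as reals, since it needs a Polish space.\<close>

lemma process_with_fdds_exists:
  fixes S :: "'s set"
  assumes S: "countable S" and p: "transition_function S p" and \<mu>: "set_pmf \<mu> \<subseteq> S"
  obtains M :: "(real \<Rightarrow> real) measure" and Z
  where "prob_space M" "\<And>t. 0 \<le> t \<Longrightarrow> Z t \<in> M \<rightarrow>\<^sub>M count_space S" "has_fdds M Z \<mu> p"
proof -
  define enc :: "'s \<Rightarrow> real" where "enc x = real (to_nat_on S x)" for x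
  \<comment> \<open>Defined on all reals with values in the nonempty set \<open>S\<close>, so that
    the decoded process takes values in \<open>S\<close> at every sample point and not only almost
    surely.\<close>
  define dec where "dec r = from_nat_into S (nat \<lfloor>r\<rfloor>)" for r :: real
  have "S \<noteq> {}"
    using \<mu> set_pmf_not_empty[of \<mu>] by blast
  then have dec_S: "dec r \<in> S" for r
    by (simp add: dec_def from_nat_into)
  have dec_enc: "dec (enc x) = x" if "x \<in> S" for x
    using S that by (simp add: enc_def dec_def)
  have dec_meas: "dec \<in> borel \<rightarrow>\<^sub>M count_space S"
  proof -
    have "(\<lambda>k. from_nat_into S (nat k)) \<in> count_space UNIV \<rightarrow>\<^sub>M count_space S"
      using \<open>S \<noteq> {}\<close> by (auto simp: from_nat_into)
    from measurable_compose[OF measurable_real_floor this] show ?thesis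
      unfolding dec_def[abs_def] .
  qed
  define F where "F ts = bind_pmf \<mu> (\<lambda>x. path_fun_pmf p 0 x ts)" for ts
  define P :: "real set \<Rightarrow> (real \<Rightarrow> real) measure" where
    "P J = distr (measure_pmf (F (sorted_list_of_set J))) (PiM J (\<lambda>_. borel)) (\<lambda>f. \<lambda>t\<in>J. enc (f t))" for J
  have enc_meas: "(\<lambda>f. \<lambda>t\<in>J. enc (f t)) \<in> measure_pmf Q \<rightarrow>\<^sub>M PiM J (\<lambda>_. borel :: real measure)"
    for J :: "real set" and Q
    by (auto simp: space_PiM)
  interpret polish_projective "{0..}" P
  proof (intro polish_projective.intro projective_family.intro)
    fix J H :: "real set" assume JH: "J \<subseteq> H" "finite H" "H \<subseteq> {0..}"
    have restr: "map_pmf (\<lambda>f. restrict f J) (F (sorted_list_of_set H)) = F (sorted_list_of_set J)"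
      unfolding F_def map_bind_pmf
    proof (rule bind_pmf_cong[OF refl])
      fix x assume "x \<in> set_pmf \<mu>"
      then show "map_pmf (\<lambda>f. restrict f J) (path_fun_pmf p 0 x (sorted_list_of_set H))
          = path_fun_pmf p 0 x (sorted_list_of_set J)"
        using restrict_path_fun_pmf[OF p, of x 0 "sorted_list_of_set H" J] \<mu> JH
        by (auto simp: sorted_list_of_set_filter)
    qed
    have "distr (P H) (PiM J (\<lambda>_. borel)) (\<lambda>f. restrict f J)
        = distr (measure_pmf (F (sorted_list_of_set H))) (PiM J (\<lambda>_. borel))
            ((\<lambda>f. restrict f J) \<circ> (\<lambda>f. \<lambda>t\<in>H. enc (f t)))"
      unfolding P_def using JH by (intro distr_distr measurable_restrict_subset enc_meas)
    also have "(\<lambda>f. restrict f J) \<circ> (\<lambda>f. \<lambda>t\<in>H. enc (f t)) = (\<lambda>f. \<lambda>t\<in>J. enc (f t)) \<circ> (\<lambda>f. restrict f J)"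
      using JH by (auto simp: fun_eq_iff)
    also have "distr (measure_pmf (F (sorted_list_of_set H))) (PiM J (\<lambda>_. borel)) \<dots>
        = distr (measure_pmf (map_pmf (\<lambda>f. restrict f J) (F (sorted_list_of_set H)))) (PiM J (\<lambda>_. borel))
            (\<lambda>f. \<lambda>t\<in>J. enc (f t))"
      unfolding map_pmf_rep_eq by (rule distr_distr[symmetric]) (auto simp: space_PiM)
    finally show "P J = distr (P H) (PiM J (\<lambda>_. borel)) (\<lambda>f. restrict f J)"
      unfolding restr P_def[of J] by (rule sym)
  next
    fix J :: "real set"
    show "prob_space (P J)"
      unfolding P_def by (intro measure_pmf.prob_space_distr enc_meas)
  qed
  define Z where "Z t \<omega> = dec (\<omega> t)" for t :: real and \<omega> :: "real \<Rightarrow> real"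
  have Z_meas: "Z t \<in> PiM J (\<lambda>_. borel) \<rightarrow>\<^sub>M count_space S" if "t \<in> J" for t J
    unfolding Z_def[abs_def] using that by (intro measurable_compose[OF _ dec_meas] measurable_component_singleton)
  have lim_restrict: "distr lim (PiM J (\<lambda>_. borel)) (\<lambda>\<omega>. restrict \<omega> J) = P J" if J: "finite J" "J \<subseteq> {0..}" for J
  proof (rule measure_eqI)
    show "sets (distr lim (PiM J (\<lambda>_. borel)) (\<lambda>\<omega>. restrict \<omega> J)) = sets (P J)"
      by (simp add: P_def)
    fix X assume "X \<in> sets (distr lim (PiM J (\<lambda>_. borel)) (\<lambda>\<omega>. restrict \<omega> J))"
    then have X: "X \<in> sets (PiM J (\<lambda>_. borel))" by simp
    have "(\<lambda>\<omega>. restrict \<omega> J) \<in> lim \<rightarrow>\<^sub>M PiM J (\<lambda>_. borel)"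
      using J by (subst measurable_cong_sets[OF sets_lim refl]) (rule measurable_restrict_subset)
    then have "emeasure (distr lim (PiM J (\<lambda>_. borel)) (\<lambda>\<omega>. restrict \<omega> J)) X
        = emeasure lim ((\<lambda>\<omega>. restrict \<omega> J) -` X \<inter> space lim)"
      using X by (rule emeasure_distr)
    also have "(\<lambda>\<omega>. restrict \<omega> J) -` X \<inter> space lim = emb {0..} J X"
      by (simp add: prod_emb_def space_PiM)
    also have "emeasure lim (emb {0..} J X) = emeasure (P J) X"
      by (rule emeasure_lim_emb[OF J(2,1) X])
    finally show "emeasure (distr lim (PiM J (\<lambda>_. borel)) (\<lambda>\<omega>. restrict \<omega> J)) X = emeasure (P J) X" .
  qed
  have "has_fdds lim Z \<mu> p"
    unfolding has_fdds_def
  proof (intro allI impI)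
    fix ts :: "real list" assume ts: "sorted (0 # ts)"
    let ?J = "set ts"
    let ?g = "\<lambda>\<omega>. map (\<lambda>t. Z t \<omega>) ts"
    have g: "?g \<in> PiM ?J (\<lambda>_. borel) \<rightarrow>\<^sub>M count_space UNIV"
      by (intro measurable_map_process[OF S] Z_meas)
    have r: "(\<lambda>\<omega>. restrict \<omega> ?J) \<in> lim \<rightarrow>\<^sub>M PiM ?J (\<lambda>_. borel)"
      using ts by (subst measurable_cong_sets[OF sets_lim refl]) (auto intro: measurable_restrict_subset)
    have "distr lim (count_space UNIV) ?g
        = distr (distr lim (PiM ?J (\<lambda>_. borel)) (\<lambda>\<omega>. restrict \<omega> ?J)) (count_space UNIV) ?g"
      unfolding distr_distr[OF g r] by (auto simp: comp_def Z_def intro!: distr_cong)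
    also have "\<dots> = distr (P ?J) (count_space UNIV) ?g"
      using ts by (subst lim_restrict) auto
    also have "\<dots> = distr (measure_pmf (F (remdups_adj ts))) (count_space UNIV) (?g \<circ> (\<lambda>f. \<lambda>t\<in>?J. enc (f t)))"
      using ts unfolding P_def by (subst distr_distr[OF g enc_meas]) (simp add: sorted_list_of_set_remdups_adj)
    also have "?g \<circ> (\<lambda>f. \<lambda>t\<in>?J. enc (f t)) = (\<lambda>f. map (\<lambda>x. dec (enc x)) (map f ts))"
      by (auto simp: Z_def)
    also have "distr (measure_pmf (F (remdups_adj ts))) (count_space UNIV) \<dots>
        = measure_pmf (bind_pmf \<mu> (\<lambda>x. map_pmf (map (\<lambda>x. dec (enc x)))
            (map_pmf (\<lambda>f. map f ts) (path_fun_pmf p 0 x (remdups_adj ts)))))"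
      by (simp add: F_def map_bind_pmf map_pmf_comp flip: map_pmf_rep_eq)
    also have "bind_pmf \<mu> (\<lambda>x. map_pmf (map (\<lambda>x. dec (enc x)))
            (map_pmf (\<lambda>f. map f ts) (path_fun_pmf p 0 x (remdups_adj ts)))) = bind_pmf \<mu> (\<lambda>x. path_pmf p 0 x ts)"
    proof (rule bind_pmf_cong[OF refl])
      fix x assume "x \<in> set_pmf \<mu>"
      then have x: "x \<in> S" using \<mu> by auto
      \<comment> \<open>Decoding inverts encoding only on \<open>S\<close>; since paths stay in
        \<open>S\<close>, the round trip is treated as a map that commutes with \<open>p\<close>
        there.\<close>
      have "map_pmf (\<lambda>x. dec (enc x)) (p t y) = p t (dec (enc y))" if "0 \<le> t" "y \<in> S" for t y
        using transition_function_closed[OF p that] by (simp add: dec_enc that cong: map_pmf_cong)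
      then have "map_pmf (map (\<lambda>x. dec (enc x))) (path_pmf p 0 x ts) = path_pmf p 0 (dec (enc x)) ts"
        by (rule map_path_pmf[OF p _ x ts])
      then show "map_pmf (map (\<lambda>x. dec (enc x))) (map_pmf (\<lambda>f. map f ts) (path_fun_pmf p 0 x (remdups_adj ts)))
          = path_pmf p 0 x ts"
        by (simp only: map_path_fun_pmf[OF p x ts] dec_enc[OF x])
    qed
    finally show "distr lim (count_space UNIV) ?g = measure_pmf (bind_pmf \<mu> (\<lambda>x. path_pmf p 0 x ts))" .
  qed
  moreover have "Z t \<in> lim \<rightarrow>\<^sub>M count_space S" if "0 \<le> t" for t
    using Z_meas[of t "{0..}"] that by (simp add: measurable_cong_sets[OF sets_lim refl])
  ultimately show thesis
    using P.prob_space_axioms by (intro that) auto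
qed

section \<open>Right-continuous versions of a chain with a clock\<close>

lemma sets_Collect_neq:
  assumes "countable S" "f \<in> M \<rightarrow>\<^sub>M count_space S" "g \<in> M \<rightarrow>\<^sub>M count_space S"
  shows "{\<omega> \<in> space M. f \<omega> \<noteq> g \<omega>} \<in> sets M"
proof -
  have "(\<lambda>\<omega>. (f \<omega>, g \<omega>)) \<in> M \<rightarrow>\<^sub>M count_space S \<Otimes>\<^sub>M count_space S"
    using assms by (intro measurable_Pair)
  also have "count_space S \<Otimes>\<^sub>M count_space S = count_space (S \<times> S)"
    using assms by (intro pair_measure_countable)
  finally have "(\<lambda>\<omega>. (f \<omega>, g \<omega>)) -` {z \<in> S \<times> S. fst z \<noteq> snd z} \<inter> space M \<in> sets M"
    by (rule measurable_sets) auto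
  also have "(\<lambda>\<omega>. (f \<omega>, g \<omega>)) -` {z \<in> S \<times> S. fst z \<noteq> snd z} \<inter> space M = {\<omega> \<in> space M. f \<omega> \<noteq> g \<omega>}"
    using assms(2,3)[THEN measurable_space] by auto
  finally show ?thesis .
qed

lemma has_fdds_AE_pair:
  assumes "has_fdds M Z \<mu> p" "countable S" "\<And>t. 0 \<le> t \<Longrightarrow> Z t \<in> M \<rightarrow>\<^sub>M count_space S"
    and p: "transition_function S p" and \<mu>: "set_pmf \<mu> \<subseteq> S"
    and R: "\<And>x y. x \<in> S \<Longrightarrow> y \<in> set_pmf (p (t - s) x) \<Longrightarrow> R x y" and "0 \<le> s" "s \<le> t"
  shows "AE \<omega> in M. R (Z s \<omega>) (Z t \<omega>)"
proof -
  have "R (xs ! 0) (xs ! 1)" if "xs \<in> set_pmf (bind_pmf \<mu> (\<lambda>x. path_pmf p 0 x [s, t]))" for xs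
  proof -
    from that obtain x y z where "x \<in> set_pmf \<mu>" "y \<in> set_pmf (p s x)" "z \<in> set_pmf (p (t - s) y)" "xs = [y, z]"
      by auto
    moreover from this have "y \<in> S"
      using transition_function_closed[OF p \<open>0 \<le> s\<close>] \<mu> by blast
    ultimately show ?thesis by (simp add: R)
  qed
  moreover have "distr M (count_space UNIV) (\<lambda>\<omega>. map (\<lambda>t. Z t \<omega>) [s, t])
      = measure_pmf (bind_pmf \<mu> (\<lambda>x. path_pmf p 0 x [s, t]))"
    using assms(1,7,8) unfolding has_fdds_def by (auto simp del: list.map path_pmf.simps)
  ultimately have "AE xs in distr M (count_space UNIV) (\<lambda>\<omega>. map (\<lambda>t. Z t \<omega>) [s, t]). R (xs ! 0) (xs ! 1)"
    by (simp only: AE_measure_pmf_iff) blast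
  then have "AE \<omega> in M. R (map (\<lambda>t. Z t \<omega>) [s, t] ! 0) (map (\<lambda>t. Z t \<omega>) [s, t] ! 1)"
    by (rule AE_distrD[rotated]) (intro measurable_map_process[OF assms(2)] assms(3), use assms(7,8) in auto)
  then show ?thesis by simp
qed

text \<open>Conditioning on the state at time \<open>s\<close> reduces the claim to the leave bound,
  which is uniform in that state.\<close>

lemma has_fdds_change_prob:
  assumes "has_fdds M Z \<mu> p" "countable S" "\<And>t. 0 \<le> t \<Longrightarrow> Z t \<in> M \<rightarrow>\<^sub>M count_space S"
    and p: "transition_function S p" and \<mu>: "set_pmf \<mu> \<subseteq> S"
    and bound: "\<And>x. x \<in> S \<Longrightarrow> 1 - pmf (p (t - s) x) x \<le> b" and "0 \<le> s" "s \<le> t"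
  shows "measure M {\<omega> \<in> space M. Z s \<omega> \<noteq> Z t \<omega>} \<le> b"
proof -
  let ?A = "{xs. xs ! 0 \<noteq> xs ! 1}"
  have "0 \<le> b"
  proof -
    obtain x where "x \<in> S" using \<mu> set_pmf_not_empty[of \<mu>] by blast
    from bound[OF this] pmf_le_1[of "p (t - s) x" x] show ?thesis by simp
  qed
  have inner: "emeasure (measure_pmf (map_pmf (\<lambda>z. [y, z]) (p (t - s) y))) ?A \<le> ennreal b" if "y \<in> S" for y
  proof -
    have "emeasure (measure_pmf (map_pmf (\<lambda>z. [y, z]) (p (t - s) y))) ?A = emeasure (p (t - s) y) (UNIV - {y})"
      by (auto intro!: arg_cong2[where f = emeasure])
    also have "\<dots> = ennreal (1 - pmf (p (t - s) y) y)"
      using measure_pmf.prob_compl[of "{y}" "p (t - s) y"]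
      by (simp add: measure_pmf.emeasure_eq_measure measure_pmf_single)
    finally show ?thesis
      using bound[OF that] by (simp add: ennreal_leI)
  qed
  have "emeasure (measure_pmf (bind_pmf \<mu> (\<lambda>x. path_pmf p 0 x [s, t]))) ?A
      = (\<integral>\<^sup>+y. emeasure (measure_pmf (map_pmf (\<lambda>z. [y, z]) (p (t - s) y))) ?A \<partial>measure_pmf (bind_pmf \<mu> (p s)))"
    by (simp add: map_bind_pmf map_pmf_def bind_assoc_pmf bind_return_pmf del: emeasure_map_pmf)
  also have "\<dots> \<le> (\<integral>\<^sup>+y. ennreal b \<partial>measure_pmf (bind_pmf \<mu> (p s)))"
  proof (rule nn_integral_mono_AE)
    have "y \<in> S" if "y \<in> set_pmf (bind_pmf \<mu> (p s))" for y
      using that transition_function_closed[OF p \<open>0 \<le> s\<close>] \<mu> by auto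
    then show "AE y in measure_pmf (bind_pmf \<mu> (p s)).
        emeasure (measure_pmf (map_pmf (\<lambda>z. [y, z]) (p (t - s) y))) ?A \<le> ennreal b"
      using inner by (simp only: AE_measure_pmf_iff) blast
  qed
  also have "\<dots> = ennreal b"
    by simp
  finally have "measure_pmf.prob (bind_pmf \<mu> (\<lambda>x. path_pmf p 0 x [s, t])) ?A \<le> b"
    using \<open>0 \<le> b\<close> by (simp add: measure_pmf.emeasure_eq_measure)
  then show ?thesis
    using measure_has_fdds[OF assms(1,2,3), of "[s, t]" ?A] assms(7,8) by simp
qed

text \<open>The function \<open>h\<close> is a clock: it is nondecreasing along paths and increases at every jump.  As it has
  values in the natural numbers, it and hence the state is constant on the rationals in some interval
  to the right of every time.\<close>

lemma regular_process_exists: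
  fixes S :: "'s set" and h :: "'s \<Rightarrow> nat"
  assumes S: "countable S" and p: "transition_function S p" and \<mu>: "set_pmf \<mu> \<subseteq> S"
    and h: "\<And>t x y. 0 \<le> t \<Longrightarrow> x \<in> S \<Longrightarrow> y \<in> set_pmf (p t x) \<Longrightarrow> h x \<le> h y \<and> (h x = h y \<longrightarrow> x = y)"
    and leave: "\<And>t x. 0 \<le> t \<Longrightarrow> x \<in> S \<Longrightarrow> 1 - pmf (p t x) x \<le> L * t"
  obtains M :: "(real \<Rightarrow> real) measure" and Y
  where "prob_space M" "\<And>t. 0 \<le> t \<Longrightarrow> Y t \<in> M \<rightarrow>\<^sub>M count_space S" "has_fdds M Y \<mu> p"
    "\<And>\<omega> t. \<omega> \<in> space M \<Longrightarrow> 0 \<le> t \<Longrightarrow> \<forall>\<^sub>F s in at_right t. Y s \<omega> = Y t \<omega>"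
proof -
  obtain M :: "(real \<Rightarrow> real) measure" and Z where "prob_space M"
    and Z: "\<And>t. 0 \<le> t \<Longrightarrow> Z t \<in> M \<rightarrow>\<^sub>M count_space S" and fdds: "has_fdds M Z \<mu> p"
    by (rule process_with_fdds_exists[OF S p \<mu>]) (rule that)
  interpret prob_space M by fact
  obtain x0 where "x0 \<in> S"
    using \<mu> set_pmf_not_empty[of \<mu>] by blast
  have Z_S: "Z t \<omega> \<in> S" if "\<omega> \<in> space M" "0 \<le> t" for t \<omega>
    using measurable_space[OF Z] that by auto
  have Z_meas: "{\<omega> \<in> space M. Z t \<omega> = x} \<in> sets M" if "0 \<le> t" for t x
  proof -
    have "{\<omega> \<in> space M. Z t \<omega> = x} = Z t -` ({x} \<inter> S) \<inter> space M"
      using Z_S that by auto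
    also have "\<dots> \<in> sets M"
      by (rule measurable_sets[OF Z[OF that]]) auto
    finally show ?thesis .
  qed
  define good where "good s t \<omega> \<longleftrightarrow> h (Z s \<omega>) \<le> h (Z t \<omega>) \<and> (h (Z s \<omega>) = h (Z t \<omega>) \<longrightarrow> Z s \<omega> = Z t \<omega>)" for s t \<omega>
  have AE_good: "AE \<omega> in M. good s t \<omega>" if "0 \<le> s" "s \<le> t" for s t
    unfolding good_def
    by (rule has_fdds_AE_pair[OF fdds S Z p \<mu>]) (use h[of "t - s"] that in auto)
  \<comment> \<open>Restricting to rational times leaves countably many pairs, hence a single null
    set \<open>N\<close>.\<close>
  have "AE \<omega> in M. \<forall>s\<in>\<rat>. \<forall>t\<in>\<rat>. 0 \<le> s \<longrightarrow> s \<le> t \<longrightarrow> good s t \<omega>"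
    using AE_good by (simp add: AE_ball_countable countable_rat)
  then obtain N where N: "N \<in> null_sets M"
    and "{\<omega> \<in> space M. \<not> (\<forall>s\<in>\<rat>. \<forall>t\<in>\<rat>. 0 \<le> s \<longrightarrow> s \<le> t \<longrightarrow> good s t \<omega>)} \<subseteq> N"
    unfolding eventually_ae_filter by auto
  then have good: "good s t \<omega>" if "\<omega> \<in> space M" "\<omega> \<notin> N" "s \<in> \<rat>" "t \<in> \<rat>" "0 \<le> s" "s \<le> t" for s t \<omega>
    using that by blast
  define const where "const t u y \<omega> \<longleftrightarrow> t < u \<and> (\<forall>s\<in>\<rat>. t < s \<and> s < u \<longrightarrow> Z s \<omega> = y)" for t u y \<omega>
  \<comment> \<open>The right limit along the rationals. On the null set the path is constant,
    because right continuity is required at every sample point.\<close>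
  define Y where "Y t \<omega> = (if \<omega> \<in> N then x0 else SOME y. \<exists>u. const t u y \<omega>)" for t \<omega>
  have Y_null: "Y t \<omega> = x0" if "\<omega> \<in> N" for t \<omega>
    using that by (simp add: Y_def)
  have const_unique: "y = y'" if "const t u y \<omega>" "const t u' y' \<omega>" for t u u' y y' \<omega>
  proof -
    have "t < min u u'" using that by (simp add: const_def)
    from Rats_dense_in_real[OF this] obtain s where "s \<in> \<rat>" "t < s" "s < min u u'" by auto
    with that show ?thesis by (auto simp: const_def)
  qed
  have const_exists: "\<exists>u y. const t u y \<omega>" if \<omega>: "\<omega> \<in> space M" "\<omega> \<notin> N" and t: "0 \<le> t" for t \<omega>
  proof -
    \<comment> \<open>The least clock value at rational times after \<open>t\<close> is attained at
      some \<open>u\<close>. Between \<open>t\<close> and \<open>u\<close> the clock is at least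
      this value by minimality and at most this value by monotonicity, so neither it nor the state
      moves.\<close>
    let ?P = "\<lambda>n. \<exists>s\<in>\<rat>. t < s \<and> h (Z s \<omega>) = n"
    obtain s where "s \<in> \<rat>" "t < s"
      using Rats_dense_in_real[of t "t + 1"] by auto
    then have "\<exists>n. ?P n" by blast
    then have "?P (Least ?P)" by (rule LeastI_ex)
    then obtain u where u: "u \<in> \<rat>" "t < u" "h (Z u \<omega>) = Least ?P" by blast
    have "Z s \<omega> = Z u \<omega>" if s: "s \<in> \<rat>" "t < s" "s < u" for s
    proof -
      have "Least ?P \<le> h (Z s \<omega>)"
        using s by (intro Least_le) auto
      then show ?thesis
        using good[OF \<omega> s(1) u(1)] t s u(3) by (simp add: good_def)
    qed
    with u(2) show ?thesis unfolding const_def by blast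
  qed
  have Y_eq: "Y t \<omega> = y" if "\<omega> \<notin> N" "const t u y \<omega>" for t u y \<omega>
    unfolding Y_def using that const_unique by (auto intro!: some_equality)
  have Y_S: "Y t \<omega> \<in> S" if \<omega>: "\<omega> \<in> space M" and t: "0 \<le> t" for t \<omega>
  proof (cases "\<omega> \<in> N")
    case True
    then show ?thesis using \<open>x0 \<in> S\<close> by (simp add: Y_null)
  next
    case False
    with const_exists \<omega> t obtain u y where c: "const t u y \<omega>" by blast
    then obtain s where "s \<in> \<rat>" "t < s" "s < u"
      using Rats_dense_in_real[of t u] by (auto simp: const_def)
    then show ?thesis
      using c Y_eq[OF False c] Z_S[OF \<omega>, of s] t by (auto simp: const_def)
  qed
  \<comment> \<open>Rational times tending to \<open>t\<close> from the right express
    \<open>Y t\<close> through countably many coordinates of \<open>Z\<close>, which gives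
    measurability.\<close>
  have "\<exists>r\<in>\<rat>. t < r \<and> r < t + inverse (Suc k)" for t :: real and k
    using Rats_dense_in_real[of t "t + inverse (Suc k)"] by auto
  then obtain r where r: "\<And>t k. r t k \<in> \<rat>" "\<And>t k. t < r t k" "\<And>t k. r t k < t + inverse (Suc k)"
    by metis
  have Y_iff: "Y t \<omega> = y \<longleftrightarrow> (\<exists>k. \<forall>j\<ge>k. Z (r t j) \<omega> = y)" if \<omega>: "\<omega> \<in> space M" "\<omega> \<notin> N" and t: "0 \<le> t" for t \<omega> y
  proof -
    obtain u z where c: "const t u z \<omega>"
      using const_exists[OF \<omega> t] by blast
    then obtain k where k: "inverse (Suc k) < u - t"
      using reals_Archimedean[of "u - t"] by (auto simp: const_def)
    have Zz: "Z (r t j) \<omega> = z" if "k \<le> j" for j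
    proof -
      have "inverse (real (Suc j)) \<le> inverse (real (Suc k))"
        using that by (intro le_imp_inverse_le) auto
      then have "r t j < u"
        using r(3)[of t j] k by linarith
      then show ?thesis
        using c r(1,2) by (auto simp: const_def)
    qed
    have "Y t \<omega> = z"
      using Y_eq[OF \<omega>(2) c] .
    then show ?thesis
      using Zz by (metis linear)
  qed
  have Y: "Y t \<in> M \<rightarrow>\<^sub>M count_space S" if t: "0 \<le> t" for t
  proof (rule measurable_count_space_eq_countable[OF S, THEN iffD2], intro conjI ballI)
    show "Y t \<in> space M \<rightarrow> S"
      using Y_S t by auto
    fix y assume "y \<in> S"
    let ?B = "{\<omega> \<in> space M. \<exists>k. \<forall>j\<in>{k..}. Z (r t j) \<omega> = y}"
    have "?B \<in> sets M"
      using t r(2)[of t] by (intro sets.sets_Collect_countable_Ex sets.sets_Collect_countable_Ball Z_meas)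
        (auto intro: less_imp_le[OF le_less_trans])
    moreover have "Y t -` {y} \<inter> space M = (?B - N) \<union> (if y = x0 then N else {})"
    proof (rule set_eqI)
      fix \<omega>
      show "\<omega> \<in> Y t -` {y} \<inter> space M \<longleftrightarrow> \<omega> \<in> (?B - N) \<union> (if y = x0 then N else {})"
      proof (cases "\<omega> \<in> N")
        case True
        then show ?thesis
          using Y_null[OF True, of t] sets.sets_into_space[OF null_setsD2[OF N]] by auto
      next
        case False
        then show ?thesis
          using Y_iff[OF _ False t, of y] by (auto simp: Ball_def)
      qed
    qed
    ultimately show "Y t -` {y} \<inter> space M \<in> sets M"
      using N by auto
  qed
  have Y_Z: "AE \<omega> in M. Y t \<omega> = Z t \<omega>" if t: "0 \<le> t" for t
  proof -
    let ?A = "{\<omega> \<in> space M. Y t \<omega> \<noteq> Z t \<omega>}"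
    have A: "?A \<in> sets M"
      by (rule sets_Collect_neq[OF S Y Z]) (use t in auto)
    have le: "prob ?A \<le> L * (r t k - t)" for k
    proof -
      \<comment> \<open>As \<open>t\<close> may be irrational, \<open>N\<close> does not cover
        comparisons with \<open>t\<close>; countably many further null sets do. If the states at
        \<open>t\<close> and \<open>r t k\<close> agree, the clock is squeezed between them, the
        path is constant there, and \<open>Y t\<close> equals \<open>Z t\<close>. A mismatch thus
        requires a change during \<open>[t, r t k]\<close>, whose probability tends to 0.\<close>
      have "AE \<omega> in M. \<forall>s\<in>\<rat> \<inter> {t<..<r t k}. good t s \<omega> \<and> good s (r t k) \<omega>"
        using t AE_good by (simp add: AE_ball_countable countable_rat)
      moreover have "\<omega> \<in> ?A \<longrightarrow> \<omega> \<in> {\<omega> \<in> space M. Z t \<omega> \<noteq> Z (r t k) \<omega>}"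
        if "\<forall>s\<in>\<rat> \<inter> {t<..<r t k}. good t s \<omega> \<and> good s (r t k) \<omega>" "\<omega> \<notin> N" for \<omega>
      proof -
        have "const t (r t k) (Z t \<omega>) \<omega>" if "Z t \<omega> = Z (r t k) \<omega>"
          using \<open>\<forall>s\<in>\<rat> \<inter> {t<..<r t k}. good t s \<omega> \<and> good s (r t k) \<omega>\<close> that r(2)
          by (fastforce simp: const_def good_def)
        then show ?thesis
          using Y_eq[OF \<open>\<omega> \<notin> N\<close>] by auto
      qed
      ultimately have "AE \<omega> in M. \<omega> \<in> ?A \<longrightarrow> \<omega> \<in> {\<omega> \<in> space M. Z t \<omega> \<noteq> Z (r t k) \<omega>}"
        using AE_not_in[OF N] by (elim AE_mp) (intro AE_I2 impI; blast)
      moreover have "{\<omega> \<in> space M. Z t \<omega> \<noteq> Z (r t k) \<omega>} \<in> sets M"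
        by (rule sets_Collect_neq[OF S Z Z]) (use t r(2)[of t k] in auto)
      ultimately have "prob ?A \<le> prob {\<omega> \<in> space M. Z t \<omega> \<noteq> Z (r t k) \<omega>}"
        by (rule finite_measure_mono_AE)
      also have "\<dots> \<le> L * (r t k - t)"
        using t r(2)[of t k] leave by (intro has_fdds_change_prob[OF fdds S Z p \<mu>]) auto
      finally show ?thesis .
    qed
    have "0 \<le> L"
      using order_trans[OF measure_nonneg le[of 0]] r(2)[of t 0] by (simp add: zero_le_mult_iff)
    have "prob ?A \<le> L * inverse (Suc k)" for k
      using le[of k] mult_left_mono[OF less_imp_le[OF r(3)[of t k]] \<open>0 \<le> L\<close>] by (simp add: algebra_simps)
    moreover have "(\<lambda>k. L * inverse (real (Suc k))) \<longlonglongrightarrow> L * 0"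
      by (intro tendsto_intros LIMSEQ_inverse_real_of_nat)
    ultimately have "prob ?A \<le> L * 0"
      by (intro LIMSEQ_le_const) auto
    then have "prob ?A = 0"
      using measure_nonneg[of M ?A] by simp
    then show ?thesis
      using A by (subst AE_iff_measurable[OF A refl]) (simp add: emeasure_eq_measure)
  qed
  have "has_fdds M Y \<mu> p"
    unfolding has_fdds_def
  proof (intro allI impI)
    fix ts :: "real list" assume ts: "sorted (0 # ts)"
    have "AE \<omega> in M. \<forall>t\<in>set ts. Y t \<omega> = Z t \<omega>"
      using ts Y_Z by (subst AE_ball_countable) (auto simp: countable_finite)
    then have "AE \<omega> in M. map (\<lambda>t. Y t \<omega>) ts = map (\<lambda>t. Z t \<omega>) ts"
      by eventually_elim simp
    then have "distr M (count_space UNIV) (\<lambda>\<omega>. map (\<lambda>t. Y t \<omega>) ts)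
        = distr M (count_space UNIV) (\<lambda>\<omega>. map (\<lambda>t. Z t \<omega>) ts)"
      by (rule distr_cong_AE[OF refl refl]) (intro measurable_map_process[OF S] Y Z, use ts in auto)+
    then show "distr M (count_space UNIV) (\<lambda>\<omega>. map (\<lambda>t. Y t \<omega>) ts)
        = measure_pmf (bind_pmf \<mu> (\<lambda>x. path_pmf p 0 x ts))"
      using fdds ts by (simp add: has_fdds_def)
  qed
  moreover have "\<forall>\<^sub>F s in at_right t. Y s \<omega> = Y t \<omega>" if \<omega>: "\<omega> \<in> space M" and t: "0 \<le> t" for \<omega> t
  proof (cases "\<omega> \<in> N")
    case True
    then show ?thesis by (simp add: Y_null)
  next
    case False
    with const_exists \<omega> t obtain u y where c: "const t u y \<omega>" by blast
    have "Y s \<omega> = Y t \<omega>" if "t < s" "s < u" for s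
    proof -
      have "const s u y \<omega>" using c that by (auto simp: const_def)
      then show ?thesis using Y_eq[OF False] c by metis
    qed
    moreover have "t < u" using c by (simp add: const_def)
    ultimately show ?thesis
      unfolding eventually_at_right_field by blast
  qed
  ultimately show thesis
    using that[of M Y] Y \<open>prob_space M\<close> by blast
qed


section \<open>The redundancy model and its monotone coupling\<close>

lemma pmf_map_pmf_of_set:
  assumes "finite A" "A \<noteq> {}"
  shows "pmf (map_pmf f (pmf_of_set A)) y = (\<Sum>a\<in>A. of_bool (y = f a)) / real (card A)"
proof -
  have "pmf (return_pmf (f a)) y = of_bool (y = f a)" for a
    by (auto simp: indicator_def)
  then show ?thesis
    using assms by (simp add: map_pmf_def pmf_bind_pmf_of_set del: pmf_return)
qed

text \<open>A point of \<open>A\<close> is drawn at once with probability \<open>1 / card B\<close>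
  and after a redraw with probability \<open>(card B - card A) / card B * (1 / card A)\<close>; the
  sum is \<open>1 / card A\<close>. This gives the smaller system of the coupling its correct
  marginal.\<close>

lemma select_from_superset:
  assumes "finite B" "A \<subseteq> B" "A \<noteq> {}"
  shows "bind_pmf (pmf_of_set B) (\<lambda>b. if b \<in> A then return_pmf b else pmf_of_set A) = pmf_of_set A"
proof (rule pmf_eqI)
  fix z
  have A: "finite A" and "B \<noteq> {}"
    using assms by (auto intro: finite_subset)
  have card: "0 < card A" "card A \<le> card B"
    using assms A by (auto simp: card_gt_0_iff card_mono)
  have "pmf (bind_pmf (pmf_of_set B) (\<lambda>b. if b \<in> A then return_pmf b else pmf_of_set A)) z
      = (\<Sum>b\<in>B. pmf (if b \<in> A then return_pmf b else pmf_of_set A) z) / real (card B)"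
    using assms(1) \<open>B \<noteq> {}\<close> by (simp add: pmf_bind_pmf_of_set)
  also have "(\<Sum>b\<in>B. pmf (if b \<in> A then return_pmf b else pmf_of_set A) z)
      = (\<Sum>b\<in>A. of_bool (b = z)) + (\<Sum>b\<in>B - A. indicator A z / real (card A))"
    using assms A by (subst sum.subset_diff[OF assms(2,1)]) (auto simp: indicator_def intro!: sum.cong)
  also have "(\<Sum>b\<in>A. of_bool (b = z)) = (indicator A z :: real)"
    using A by (simp add: indicator_def of_bool_def)
  also have "(\<Sum>b\<in>B - A. indicator A z / real (card A)) = (real (card B) - real (card A)) * (indicator A z / real (card A))"
    using assms A card by (simp add: card_Diff_subset of_nat_diff)
  also have "(indicator A z + (real (card B) - real (card A)) * (indicator A z / real (card A))) / real (card B)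
      = pmf (pmf_of_set A) z"
    using assms A card \<open>B \<noteq> {}\<close> by (simp add: field_simps)
  finally show "pmf (bind_pmf (pmf_of_set B) (\<lambda>b. if b \<in> A then return_pmf b else pmf_of_set A)) z
      = pmf (pmf_of_set A) z" .
qed

section \<open>The one-step coupling and its invariants\<close>

lemma finite_classes: "finite (classes n d)"
  by (rule finite_subset[of _ "Pow {1..n}"]) (auto simp: classes_def)

lemma card_classes: "card (classes n d) = n choose d"
  unfolding classes_def using n_subsets[of "{1..n}" d] by simp

lemma countable_states: "countable (states n d)"
proof -
  have "states n d \<subseteq> (\<lambda>f c. if c \<in> classes n d then f c else 0) ` (PiE (classes n d) (\<lambda>_. UNIV))"
  proof
    fix x assume "x \<in> states n d"
    then have "x = (\<lambda>c. if c \<in> classes n d then restrict x (classes n d) c else 0)"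
      by (auto simp: states_def fun_eq_iff)
    then show "x \<in> (\<lambda>f c. if c \<in> classes n d then f c else 0) ` (PiE (classes n d) (\<lambda>_. UNIV))"
      by (intro image_eqI[where x = "restrict x (classes n d)"]) auto
  qed
  moreover have "countable (PiE (classes n d) (\<lambda>_. UNIV :: nat set))"
    by (intro countable_PiE finite_classes) auto
  ultimately show ?thesis
    by (rule countable_subset[OF _ countable_image])
qed

text \<open>The jobs of server \<open>j\<close>: the pair \<open>(c, k)\<close> is the \<open>k\<close>-th job of class \<open>c\<close>.\<close>

definition jobs :: "nat \<Rightarrow> nat \<Rightarrow> state \<Rightarrow> nat \<Rightarrow> (nat set \<times> nat) set" where
  "jobs n d x j = (SIGMA c:{c \<in> classes n d. j \<in> c}. {..<x c})"

definition arrive :: "nat set \<Rightarrow> state \<Rightarrow> state" where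
  "arrive c x = x(c := x c + 1)"

definition depart :: "nat set \<times> nat \<Rightarrow> state \<Rightarrow> state" where
  "depart a x = x(fst a := x (fst a) - 1)"

text \<open>An idle server makes a fictitious jump, which keeps the rate of each server equal to 1
  in all states.\<close>

definition serve :: "nat \<Rightarrow> nat \<Rightarrow> state \<Rightarrow> nat \<Rightarrow> state pmf" where
  "serve n d x j = (if jobs n d x j = {} then return_pmf x
     else map_pmf (\<lambda>a. depart a x) (pmf_of_set (jobs n d x j)))"

definition step :: "nat \<Rightarrow> nat \<Rightarrow> real \<Rightarrow> state \<Rightarrow> state pmf" where
  "step n d lam x = bind_pmf (bernoulli_pmf (lam / (1 + lam))) (\<lambda>b.
     if b then map_pmf (\<lambda>c. arrive c x) (pmf_of_set (classes n d))
     else bind_pmf (pmf_of_set {1..n}) (serve n d x))"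

definition serve_pair :: "nat \<Rightarrow> nat \<Rightarrow> state \<times> state \<Rightarrow> nat \<Rightarrow> (state \<times> state) pmf" where
  "serve_pair n d w j = (if jobs n d (snd w) j = {} then return_pmf w
     else bind_pmf (pmf_of_set (jobs n d (snd w) j)) (\<lambda>a.
       if jobs n d (fst w) j = {} then return_pmf (fst w, depart a (snd w))
       else map_pmf (\<lambda>b. (depart b (fst w), depart a (snd w)))
         (if a \<in> jobs n d (fst w) j then return_pmf a else pmf_of_set (jobs n d (fst w) j))))"

definition step_pair :: "nat \<Rightarrow> nat \<Rightarrow> real \<Rightarrow> state \<times> state \<Rightarrow> (state \<times> state) pmf" where
  "step_pair n d lam w = bind_pmf (bernoulli_pmf (lam / (1 + lam))) (\<lambda>b.
     if b then map_pmf (\<lambda>c. (arrive c (fst w), arrive c (snd w))) (pmf_of_set (classes n d))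
     else bind_pmf (pmf_of_set {1..n}) (serve_pair n d w))"

lemma finite_jobs: "finite (jobs n d x j)"
  using finite_classes by (auto simp: jobs_def)

lemma card_jobs: "card (jobs n d x j) = queue n d x j"
  using finite_classes[of n d] by (simp add: jobs_def queue_def card_SigmaI)

text \<open>Numbering the jobs of each class from 0 turns the order of states into inclusion of job
  sets.\<close>

lemma jobs_mono: "x \<le> y \<Longrightarrow> jobs n d x j \<subseteq> jobs n d y j"
  by (auto simp: jobs_def le_fun_def intro: less_le_trans)

text \<open>The order enters through the inclusion of the job sets, without which keeping or
  redrawing the job would not be uniform on the jobs of \<open>fst w\<close>.\<close>

lemma map_fst_serve_pair:
  assumes "fst w \<le> snd w"
  shows "map_pmf fst (serve_pair n d w j) = serve n d (fst w) j"
proof -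
  note jm = jobs_mono[OF assms, of n d j]
  show ?thesis
  proof (cases "jobs n d (fst w) j = {}")
    case True
    then show ?thesis by (simp add: serve_pair_def serve_def map_bind_pmf)
  next
    case False
    then have "map_pmf fst (serve_pair n d w j) = map_pmf (\<lambda>b. depart b (fst w))
        (bind_pmf (pmf_of_set (jobs n d (snd w) j))
          (\<lambda>a. if a \<in> jobs n d (fst w) j then return_pmf a else pmf_of_set (jobs n d (fst w) j)))"
      using jm by (auto simp: serve_pair_def map_bind_pmf map_pmf_comp)
    also have "\<dots> = serve n d (fst w) j"
      using False by (simp add: select_from_superset[OF finite_jobs jm] serve_def)
    finally show ?thesis .
  qed
qed

lemma map_snd_serve_pair: "map_pmf snd (serve_pair n d w j) = serve n d (snd w) j"
proof -
  have "map_pmf snd (if jobs n d (fst w) j = {} then return_pmf (fst w, depart a (snd w))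
       else map_pmf (\<lambda>b. (depart b (fst w), depart a (snd w)))
         (if a \<in> jobs n d (fst w) j then return_pmf a else pmf_of_set (jobs n d (fst w) j)))
      = return_pmf (depart a (snd w))" for a
    by (simp add: map_pmf_comp)
  then show ?thesis
    unfolding serve_pair_def serve_def
    by (simp only: if_distrib[of "map_pmf snd"] map_bind_pmf map_return_pmf) (simp add: map_pmf_def)
qed

lemma map_fst_step_pair: "fst w \<le> snd w \<Longrightarrow> map_pmf fst (step_pair n d lam w) = step n d lam (fst w)"
  unfolding step_pair_def step_def map_bind_pmf
  by (rule bind_pmf_cong[OF refl]) (simp add: map_bind_pmf map_pmf_comp map_fst_serve_pair)

lemma map_snd_step_pair: "map_pmf snd (step_pair n d lam w) = step n d lam (snd w)"
  unfolding step_pair_def step_def map_bind_pmf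
  by (rule bind_pmf_cong[OF refl]) (simp add: map_bind_pmf map_pmf_comp map_snd_serve_pair)

lemma arrive_states: "c \<in> classes n d \<Longrightarrow> x \<in> states n d \<Longrightarrow> arrive c x \<in> states n d"
  by (auto simp: arrive_def states_def)

lemma depart_states: "x \<in> states n d \<Longrightarrow> depart a x \<in> states n d"
  by (auto simp: depart_def states_def)

lemma arrive_mono: "x \<le> y \<Longrightarrow> arrive c x \<le> arrive c y"
  by (auto simp: arrive_def le_fun_def)

lemma depart_mono: "x \<le> y \<Longrightarrow> depart a x \<le> depart a y"
  by (auto simp: depart_def le_fun_def diff_le_mono)

lemma depart_le: "depart a x \<le> x"
  by (auto simp: depart_def le_fun_def)

text \<open>A job \<open>(c, k)\<close> of \<open>y\<close> that \<open>x\<close> lacks satisfies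
  \<open>x c \<le> k < y c\<close>, so there is room for \<open>y\<close> to lose one job of class
  \<open>c\<close>.\<close>

lemma depart_new_job:
  assumes "x \<le> y" "a \<in> jobs n d y j" "a \<notin> jobs n d x j"
  shows "x \<le> depart a y"
proof -
  have "x (fst a) < y (fst a)"
    using assms(2,3) by (auto simp: jobs_def)
  then show ?thesis
    using assms(1) by (auto simp: depart_def le_fun_def)
qed

definition ordered_pairs :: "nat \<Rightarrow> nat \<Rightarrow> (state \<times> state) set" where
  "ordered_pairs n d = {(x, y). x \<in> states n d \<and> y \<in> states n d \<and> x \<le> y}"

text \<open>If both systems lose the same job, \<open>depart_mono\<close> applies. Otherwise the job
  leaving \<open>y\<close> is absent from \<open>x\<close>, and \<open>x \<le> depart a y\<close>
  holds even before \<open>x\<close> shrinks.\<close>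

lemma set_serve_pair:
  assumes "w \<in> ordered_pairs n d"
  shows "set_pmf (serve_pair n d w j) \<subseteq> ordered_pairs n d"
proof -
  obtain x y where w: "w = (x, y)" and xy: "x \<in> states n d" "y \<in> states n d" "x \<le> y"
    using assms by (auto simp: ordered_pairs_def)
  note fin = finite_jobs[of n d x j] finite_jobs[of n d y j]
  have "depart b x \<le> depart a y" if "a \<in> jobs n d y j" "a \<notin> jobs n d x j" for a b
    using depart_new_job[OF xy(3) that] depart_le[of b x] by (rule order_trans[rotated])
  then show ?thesis
    using xy fin depart_new_job[OF xy(3)] unfolding serve_pair_def w
    by (auto simp: ordered_pairs_def depart_states depart_mono set_pmf_of_set split: if_splits)
qed

lemma classes_nonempty: "d \<le> n \<Longrightarrow> classes n d \<noteq> {}"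
  using card_classes[of n d] by (auto simp: card_gt_0_iff)

lemma set_step_pair:
  assumes "d \<le> n" "w \<in> ordered_pairs n d"
  shows "set_pmf (step_pair n d lam w) \<subseteq> ordered_pairs n d"
proof -
  have "(arrive c (fst w), arrive c (snd w)) \<in> ordered_pairs n d" if "c \<in> classes n d" for c
    using that assms(2) by (auto simp: ordered_pairs_def arrive_states arrive_mono)
  moreover have "set_pmf (pmf_of_set (classes n d)) = classes n d"
    using classes_nonempty[OF assms(1)] finite_classes by (intro set_pmf_of_set)
  ultimately show ?thesis
    using subsetD[OF set_serve_pair[OF assms(2)]] unfolding step_pair_def
    by (auto split: if_splits)
qed

text \<open>Read off from the coupled step started on the diagonal.\<close>

lemma set_step:
  assumes "d \<le> n" "x \<in> states n d"
  shows "set_pmf (step n d lam x) \<subseteq> states n d"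
proof -
  have "(x, x) \<in> ordered_pairs n d"
    using assms by (simp add: ordered_pairs_def)
  from set_step_pair[OF assms(1) this, of lam] have "fst ` set_pmf (step_pair n d lam (x, x)) \<subseteq> states n d"
    by (auto simp: ordered_pairs_def)
  then show ?thesis
    using map_fst_step_pair[of "(x, x)" n d lam] by (simp flip: set_map_pmf)
qed

text \<open>For a busy server the weights \<open>x c / queue\<close> sum to 1, so the term for
  staying at \<open>x\<close> can be distributed over the classes. For an idle server division by
  zero makes the right side 0, in agreement with the fictitious jump.\<close>

lemma pmf_serve:
  "pmf (serve n d x j) y - of_bool (y = x)
    = (\<Sum>c\<in>{c \<in> classes n d. j \<in> c}. real (x c) / real (queue n d x j) *
        (of_bool (y = x(c := x c - 1)) - of_bool (y = x)))"
proof (cases "jobs n d x j = {}")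
  case True
  then have "queue n d x j = 0"
    using card_jobs[of n d x j] by simp
  with True show ?thesis
    by (simp add: serve_def indicator_def)
next
  case False
  have q: "0 < queue n d x j"
    using False finite_jobs[of n d x j] by (simp add: card_gt_0_iff flip: card_jobs)
  have "pmf (serve n d x j) y = (\<Sum>a\<in>jobs n d x j. of_bool (y = depart a x)) / real (queue n d x j)"
    using False by (simp add: serve_def pmf_map_pmf_of_set finite_jobs card_jobs)
  also have "(\<Sum>a\<in>jobs n d x j. of_bool (y = depart a x))
      = (\<Sum>c\<in>{c \<in> classes n d. j \<in> c}. \<Sum>k<x c. (of_bool (y = depart (c, k) x) :: real))"
    unfolding jobs_def using finite_classes[of n d] by (subst sum.Sigma) (auto simp: split_def)
  also have "\<dots> = (\<Sum>c\<in>{c \<in> classes n d. j \<in> c}. real (x c) * of_bool (y = x(c := x c - 1)))"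
    by (simp add: depart_def)
  finally have "pmf (serve n d x j) y
      = (\<Sum>c\<in>{c \<in> classes n d. j \<in> c}. real (x c) / real (queue n d x j) * of_bool (y = x(c := x c - 1)))"
    by (simp only: sum_divide_distrib times_divide_eq_left)
  moreover have "(\<Sum>c\<in>{c \<in> classes n d. j \<in> c}. real (x c) / real (queue n d x j)) = 1"
    using q by (simp add: queue_def flip: sum_divide_distrib of_nat_sum)
  ultimately show ?thesis
    by (simp add: right_diff_distrib sum_subtractf flip: sum_distrib_right)
qed

text \<open>The constant is the total rate: \<open>n * lam\<close> for arrivals and 1 for each of
  the \<open>n\<close> servers. Conditioning on the type of event gives the probabilities
  \<open>lam / (1 + lam)\<close> and \<open>1 / (1 + lam)\<close>.\<close>

lemma generator_eq_step:
  assumes "1 \<le> d" "d \<le> n" "0 < lam"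
  shows "generator n d lam x y = real n * (1 + lam) * (pmf (step n d lam x) y - of_bool (y = x))"
proof -
  let ?C = "classes n d" and ?e = "of_bool (y = x) :: real"
  let ?up = "\<lambda>c. of_bool (y = x(c := x c + 1)) :: real" and ?down = "\<lambda>c. of_bool (y = x(c := x c - 1)) :: real"
  have n: "0 < n" using assms by simp
  have m: "real (card ?C) = real (n choose d)" "0 < n choose d"
    using assms by (simp_all add: card_classes)
  have up: "real n * lam * (pmf (map_pmf (\<lambda>c. arrive c x) (pmf_of_set ?C)) y - ?e)
      = (\<Sum>c\<in>?C. rate_up n d lam * (?up c - ?e))"
  proof -
    have "pmf (map_pmf (\<lambda>c. arrive c x) (pmf_of_set ?C)) y = (\<Sum>c\<in>?C. ?up c) / real (n choose d)"
      using assms by (simp add: pmf_map_pmf_of_set finite_classes classes_nonempty arrive_def card_classes)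
    moreover have "(\<Sum>c\<in>?C. ?up c - ?e) = (\<Sum>c\<in>?C. ?up c) - real (n choose d) * ?e"
      by (simp add: sum_subtractf card_classes)
    moreover have "(\<Sum>c\<in>?C. rate_up n d lam * (?up c - ?e)) = rate_up n d lam * (\<Sum>c\<in>?C. ?up c - ?e)"
      by (rule sum_distrib_left[symmetric])
    moreover have "real n * lam * (s / real (n choose d) - e)
        = rate_up n d lam * (s - real (n choose d) * e)" for s e
      using m(2) by (simp add: rate_up_def field_simps)
    ultimately show ?thesis
      by (simp only:)
  qed
  have "real n * (pmf (bind_pmf (pmf_of_set {1..n}) (serve n d x)) y - ?e)
      = (\<Sum>j\<in>{1..n}. pmf (serve n d x j) y - ?e)"
    using n by (simp add: pmf_bind_pmf_of_set sum_subtractf right_diff_distrib)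
  also have "\<dots> = (\<Sum>j\<in>{1..n}. \<Sum>c\<in>{c \<in> ?C. j \<in> c}. real (x c) / real (queue n d x j) * (?down c - ?e))"
    by (simp only: pmf_serve)
  \<comment> \<open>Exchanging the sums regroups departures: the total over the classes at each
    server becomes the total over the servers of each class, which is
    \<open>rate_down\<close>.\<close>
  also have "\<dots> = (\<Sum>c\<in>?C. \<Sum>j\<in>{j \<in> {1..n}. j \<in> c}. real (x c) / real (queue n d x j) * (?down c - ?e))"
    by (rule sum.swap_restrict) (auto simp: finite_classes)
  also have "\<dots> = (\<Sum>c\<in>?C. rate_down n d c x * (?down c - ?e))"
  proof (rule sum.cong[OF refl])
    fix c assume "c \<in> ?C"
    then have "{j \<in> {1..n}. j \<in> c} = c"
      by (auto simp: classes_def)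
    then show "(\<Sum>j\<in>{j \<in> {1..n}. j \<in> c}. real (x c) / real (queue n d x j) * (?down c - ?e))
        = rate_down n d c x * (?down c - ?e)"
      by (simp only: rate_down_def sum_distrib_left sum_distrib_right times_divide_eq_right mult_1_right)
  qed
  finally have down: "real n * (pmf (bind_pmf (pmf_of_set {1..n}) (serve n d x)) y - ?e)
      = (\<Sum>c\<in>?C. rate_down n d c x * (?down c - ?e))" .
  have "pmf (step n d lam x) y
      = lam / (1 + lam) * pmf (map_pmf (\<lambda>c. arrive c x) (pmf_of_set ?C)) y
        + 1 / (1 + lam) * pmf (bind_pmf (pmf_of_set {1..n}) (serve n d x)) y"
    using assms unfolding step_def pmf_bind[of "bernoulli_pmf _"]
    by (subst integral_bernoulli_pmf) (auto simp: field_simps)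
  moreover have "real n * (1 + lam) * (lam / (1 + lam) * a + 1 / (1 + lam) * b - e)
      = real n * lam * (a - e) + real n * (b - e)" for a b e
  proof -
    define k where "k = inverse (1 + lam)"
    have "real n * (1 + lam) * (lam / (1 + lam) * a + 1 / (1 + lam) * b - e)
        = real n * ((1 + lam) * k) * (lam * a + b) - real n * (1 + lam) * e"
      unfolding divide_inverse k_def[symmetric] mult_1_left by (simp add: algebra_simps)
    also have "(1 + lam) * k = 1"
      using assms by (simp add: k_def)
    finally show ?thesis
      by (simp add: algebra_simps)
  qed
  ultimately have "real n * (1 + lam) * (pmf (step n d lam x) y - ?e)
      = real n * lam * (pmf (map_pmf (\<lambda>c. arrive c x) (pmf_of_set ?C)) y - ?e)
        + real n * (pmf (bind_pmf (pmf_of_set {1..n}) (serve n d x)) y - ?e)"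
    by (simp only:)
  also have "\<dots> = generator n d lam x y"
    unfolding up down generator_def
    by (simp add: sum.distrib sum_subtractf algebra_simps sum_distrib_left)
  finally show ?thesis by simp
qed

lemma has_generator_uniformized_step:
  assumes "1 \<le> d" "d \<le> n" "0 < lam"
  shows "has_generator (states n d) (uniformized (real n * (1 + lam)) (step n d lam)) (generator n d lam)"
  unfolding has_generator_def generator_eq_step[OF assms]
  using assms by (intro ballI uniformized_derivative) simp

text \<open>The counter records every ring, including fictitious jumps. Equal counters mean that
  there was no ring at all, hence no movement; this is the clock property needed for
  \<open>regular_process_exists\<close>.\<close>

lemma set_uniformized_counter:
  assumes "\<And>w i. K (w, i) = map_pmf (\<lambda>w'. (w', Suc i)) (J w)" "z \<in> set_pmf (uniformized L K t x)"
  shows "snd x \<le> snd z \<and> (snd x = snd z \<longrightarrow> x = z)"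
proof -
  have "snd z = snd x + k" if "z \<in> set_pmf (iter_pmf K k x)" for k
    using that
  proof (induction k arbitrary: x)
    case (Suc k)
    then obtain y where "y \<in> set_pmf (K x)" "z \<in> set_pmf (iter_pmf K k y)"
      by auto
    moreover from this(1) have "snd y = Suc (snd x)"
      using assms(1)[of "fst x" "snd x"] by auto
    ultimately show ?case
      using Suc.IH by simp
  qed simp
  moreover obtain k where "z \<in> set_pmf (iter_pmf K k x)"
    using assms(2) by (auto simp: uniformized_def)
  ultimately show ?thesis
    by (cases k) fastforce+
qed

text \<open>The coupled chain runs on \<open>W\<close>, ordered pairs together with the counter. The
  process takes values in \<open>W\<close> at every sample point, so the order holds everywhere and
  not only almost surely; projections remove the counter and give the marginals.\<close>

lemma ordered_chains_exist:
  fixes \<nu> :: "(state \<times> state) pmf"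
  assumes "1 \<le> d" "d \<le> n" "0 < lam" and \<nu>: "set_pmf \<nu> \<subseteq> ordered_pairs n d"
  defines "u \<equiv> uniformized (real n * (1 + lam)) (step n d lam)"
  obtains M :: "(real \<Rightarrow> real) measure" and V V'
  where "prob_space M"
    "\<And>\<omega> t. \<omega> \<in> space M \<Longrightarrow> 0 \<le> t \<Longrightarrow> V t \<omega> \<le> V' t \<omega>"
    "\<And>t. 0 \<le> t \<Longrightarrow> V t \<in> M \<rightarrow>\<^sub>M count_space (states n d)"
    "\<And>t. 0 \<le> t \<Longrightarrow> V' t \<in> M \<rightarrow>\<^sub>M count_space (states n d)"
    "has_fdds M V (map_pmf fst \<nu>) u" "has_fdds M V' (map_pmf snd \<nu>) u"
    "\<And>\<omega> t. \<omega> \<in> space M \<Longrightarrow> 0 \<le> t \<Longrightarrow> \<forall>\<^sub>F s in at_right t. V s \<omega> = V t \<omega>"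
    "\<And>\<omega> t. \<omega> \<in> space M \<Longrightarrow> 0 \<le> t \<Longrightarrow> \<forall>\<^sub>F s in at_right t. V' s \<omega> = V' t \<omega>"
proof -
  let ?L = "real n * (1 + lam)"
  define W where "W = ordered_pairs n d \<times> (UNIV :: nat set)"
  define K where "K = (\<lambda>(w, i). map_pmf (\<lambda>w'. (w', Suc i)) (step_pair n d lam w))"
  have L: "0 \<le> ?L" using assms by simp
  have "ordered_pairs n d \<subseteq> states n d \<times> states n d"
    by (auto simp: ordered_pairs_def)
  then have W: "countable W"
    unfolding W_def using countable_states by (intro countable_SIGMA) (auto intro: countable_subset)
  have K: "set_pmf (K x) \<subseteq> W" if "x \<in> W" for x
    using that set_step_pair[OF assms(2), of _ lam] by (fastforce simp: W_def K_def)
  note tf = transition_function_uniformized[OF L K]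
  define \<mu> where "\<mu> = map_pmf (\<lambda>w. (w, 0 :: nat)) \<nu>"
  have \<mu>: "set_pmf \<mu> \<subseteq> W"
    using \<nu> by (auto simp: \<mu>_def W_def)
  obtain M :: "(real \<Rightarrow> real) measure" and Y where M: "prob_space M"
    and Y: "\<And>t. 0 \<le> t \<Longrightarrow> Y t \<in> M \<rightarrow>\<^sub>M count_space W" and fdds: "has_fdds M Y \<mu> (uniformized ?L K)"
    and right: "\<And>\<omega> t. \<omega> \<in> space M \<Longrightarrow> 0 \<le> t \<Longrightarrow> \<forall>\<^sub>F s in at_right t. Y s \<omega> = Y t \<omega>"
  proof (rule regular_process_exists[OF W tf \<mu>, where h = snd and L = ?L])
    show "snd x \<le> snd y \<and> (snd x = snd y \<longrightarrow> x = y)" if "y \<in> set_pmf (uniformized ?L K t x)" for t x y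
      using that by (rule set_uniformized_counter[rotated]) (simp add: K_def)
    show "1 - pmf (uniformized ?L K t x) x \<le> ?L * t" if "0 \<le> t" for t x
      using pmf_uniformized_diagonal[OF L that, of K x] by simp
  qed (assumption | rule that)+
  have W_proj: "fst (fst x) \<in> states n d" "snd (fst x) \<in> states n d" "fst (fst x) \<le> snd (fst x)" if "x \<in> W" for x
    using that by (auto simp: W_def ordered_pairs_def)
  have fst_fdds: "has_fdds M (\<lambda>t \<omega>. fst (fst (Y t \<omega>))) (map_pmf (\<lambda>x. fst (fst x)) \<mu>) u"
    unfolding u_def
  proof (rule has_fdds_map[OF fdds W Y \<mu> tf])
    show "map_pmf (\<lambda>x. fst (fst x)) (uniformized ?L K t x) = uniformized ?L (step n d lam) t (fst (fst x))"
      if "x \<in> W" for t x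
      using K _ that
    proof (rule map_uniformized)
      show "map_pmf (\<lambda>x. fst (fst x)) (K x) = step n d lam (fst (fst x))" if "x \<in> W" for x
        using that map_fst_step_pair[of "fst x" n d lam] W_proj[OF that]
        by (simp add: K_def split_def map_pmf_comp)
    qed
  qed
  have snd_fdds: "has_fdds M (\<lambda>t \<omega>. snd (fst (Y t \<omega>))) (map_pmf (\<lambda>x. snd (fst x)) \<mu>) u"
    unfolding u_def
  proof (rule has_fdds_map[OF fdds W Y \<mu> tf])
    show "map_pmf (\<lambda>x. snd (fst x)) (uniformized ?L K t x) = uniformized ?L (step n d lam) t (snd (fst x))"
      if "x \<in> W" for t x
      using K _ that
    proof (rule map_uniformized)
      show "map_pmf (\<lambda>x. snd (fst x)) (K x) = step n d lam (snd (fst x))" for x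
        using map_snd_step_pair[of n d lam "fst x"] by (simp add: K_def split_def map_pmf_comp)
    qed
  qed
  have meas: "(\<lambda>\<omega>. g (Y t \<omega>)) \<in> M \<rightarrow>\<^sub>M count_space (states n d)"
    if "0 \<le> t" "\<And>x. x \<in> W \<Longrightarrow> g x \<in> states n d" for g t
    using that by (intro measurable_compose[OF Y]) auto
  show thesis
  proof (rule that[OF M])
    show "has_fdds M (\<lambda>t \<omega>. fst (fst (Y t \<omega>))) (map_pmf fst \<nu>) u"
      using fst_fdds by (simp add: \<mu>_def map_pmf_comp)
    show "has_fdds M (\<lambda>t \<omega>. snd (fst (Y t \<omega>))) (map_pmf snd \<nu>) u"
      using snd_fdds by (simp add: \<mu>_def map_pmf_comp)
    show "fst (fst (Y t \<omega>)) \<le> snd (fst (Y t \<omega>))" if "\<omega> \<in> space M" "0 \<le> t" for \<omega> t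
      using measurable_space[OF Y[OF that(2)] that(1)] W_proj(3) by simp
    show "\<forall>\<^sub>F s in at_right t. fst (fst (Y s \<omega>)) = fst (fst (Y t \<omega>))" if "\<omega> \<in> space M" "0 \<le> t" for \<omega> t
      using right[OF that] by eventually_elim simp
    show "\<forall>\<^sub>F s in at_right t. snd (fst (Y s \<omega>)) = snd (fst (Y t \<omega>))" if "\<omega> \<in> space M" "0 \<le> t" for \<omega> t
      using right[OF that] by eventually_elim simp
  qed (intro meas W_proj; assumption)+
qed

section \<open>Transfer to the given chains and to the space of paths\<close>

lemma has_fdds_cong:
  assumes "has_fdds M X \<mu> p" "transition_function S p" "set_pmf \<mu> \<subseteq> S"
    and "\<And>t x. 0 \<le> t \<Longrightarrow> x \<in> S \<Longrightarrow> p t x = p' t x"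
  shows "has_fdds M X \<mu> p'"
  unfolding has_fdds_def
proof (intro allI impI)
  fix ts :: "real list" assume ts: "sorted (0 # ts)"
  have "bind_pmf \<mu> (\<lambda>x. path_pmf p 0 x ts) = bind_pmf \<mu> (\<lambda>x. path_pmf p' 0 x ts)"
    by (rule bind_pmf_cong[OF refl], rule path_pmf_cong[OF assms(2,4)]) (use assms(3) ts in auto)
  then show "distr M (count_space UNIV) (\<lambda>\<omega>. map (\<lambda>t. X t \<omega>) ts) = measure_pmf (bind_pmf \<mu> (\<lambda>x. path_pmf p' 0 x ts))"
    using assms(1) ts by (simp add: has_fdds_def)
qed

text \<open>The transition function supplied by \<open>markov_chain\<close> depends on the chain;
  uniqueness identifies it with the uniformized one, so both given chains share the same
  semigroup.\<close>

lemma redundancy_chain_has_fdds: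
  assumes "1 \<le> d" "d \<le> n" "0 < lam" "redundancy_chain n d lam M X"
    and \<mu>: "distr M (count_space UNIV) (X 0) = measure_pmf \<mu>"
  shows "has_fdds M X \<mu> (uniformized (real n * (1 + lam)) (step n d lam))"
proof -
  obtain p \<mu>' where p: "transition_function (states n d) p" "has_generator (states n d) p (generator n d lam)"
    and fdds: "has_fdds M X \<mu>' p" and \<mu>': "distr M (count_space UNIV) (X 0) = measure_pmf \<mu>'" "set_pmf \<mu>' \<subseteq> states n d"
    using has_fdds_if_markov_chain[OF assms(4) countable_states] by blast
  have "\<mu>' = \<mu>"
    using \<mu> \<mu>'(1) by (simp add: measure_pmf_inject)
  moreover have "p t x = uniformized (real n * (1 + lam)) (step n d lam) t x" if "0 \<le> t" "x \<in> states n d" for t x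
    using that assms(1-3) by (intro transition_function_unique[OF _ set_step p]) (auto simp: generator_eq_step)
  ultimately show ?thesis
    using has_fdds_cong[OF fdds p(1) \<mu>'(2)] by simp
qed

lemma has_fdds_distr:
  assumes "has_fdds M V \<mu> p" "\<Phi> \<in> M \<rightarrow>\<^sub>M N" "countable S" "\<And>t. 0 \<le> t \<Longrightarrow> Y t \<in> N \<rightarrow>\<^sub>M count_space S"
    and "\<And>t \<omega>. 0 \<le> t \<Longrightarrow> \<omega> \<in> space M \<Longrightarrow> Y t (\<Phi> \<omega>) = V t \<omega>"
  shows "has_fdds (distr M N \<Phi>) Y \<mu> p"
  unfolding has_fdds_def
proof (intro allI impI)
  fix ts :: "real list" assume ts: "sorted (0 # ts)"
  have "distr (distr M N \<Phi>) (count_space UNIV) (\<lambda>\<omega>. map (\<lambda>t. Y t \<omega>) ts)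
      = distr M (count_space UNIV) ((\<lambda>\<omega>. map (\<lambda>t. Y t \<omega>) ts) \<circ> \<Phi>)"
    by (rule distr_distr[OF measurable_map_process[OF assms(3,4)] assms(2)]) (use ts in auto)
  also have "\<dots> = distr M (count_space UNIV) (\<lambda>\<omega>. map (\<lambda>t. V t \<omega>) ts)"
    using ts assms(5) by (intro distr_cong) auto
  finally show "distr (distr M N \<Phi>) (count_space UNIV) (\<lambda>\<omega>. map (\<lambda>t. Y t \<omega>) ts)
      = measure_pmf (bind_pmf \<mu> (\<lambda>x. path_pmf p 0 x ts))"
    using assms(1) ts by (simp add: has_fdds_def)
qed

text \<open>The right side depends only on \<open>\<mu>\<close> and \<open>p\<close>, so
  expectations can be moved to a space on which the two processes are ordered.\<close>

lemma integral_has_fdds: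
  fixes f :: "'s \<Rightarrow> real"
  assumes "has_fdds M X \<mu> p" "countable S" "\<And>t. 0 \<le> t \<Longrightarrow> X t \<in> M \<rightarrow>\<^sub>M count_space S" "0 \<le> t"
  shows "(\<integral>\<omega>. f (X t \<omega>) \<partial>M) = measure_pmf.expectation (bind_pmf \<mu> (\<lambda>x. path_pmf p 0 x [t])) (\<lambda>xs. f (hd xs))"
proof -
  have "(\<lambda>\<omega>. map (\<lambda>t. X t \<omega>) [t]) \<in> M \<rightarrow>\<^sub>M count_space UNIV"
    by (rule measurable_map_process[OF assms(2,3)]) (use assms(4) in auto)
  then have "(\<integral>\<omega>. f (hd (map (\<lambda>t. X t \<omega>) [t])) \<partial>M)
      = (\<integral>xs. f (hd xs) \<partial>distr M (count_space UNIV) (\<lambda>\<omega>. map (\<lambda>t. X t \<omega>) [t]))"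
    by (rule integral_distr[symmetric]) auto
  also have "distr M (count_space UNIV) (\<lambda>\<omega>. map (\<lambda>t. X t \<omega>) [t])
      = measure_pmf (bind_pmf \<mu> (\<lambda>x. path_pmf p 0 x [t]))"
    using assms(1,4) unfolding has_fdds_def by (auto simp del: list.map path_pmf.simps)
  finally show ?thesis by simp
qed

lemma distr_count_space_UNIV:
  assumes "f \<in> M \<rightarrow>\<^sub>M count_space S"
  shows "distr M (count_space UNIV) f = distr (distr M (count_space S) f) (count_space UNIV) (\<lambda>x. x)"
  using assms by (subst distr_distr) (auto simp: comp_def)

text \<open>The initial states live on different sample spaces, so their order is expressed through
  copies \<open>xi\<close> and \<open>xi'\<close> on a common space \<open>N\<close>.\<close>

theorem theorem3:
  fixes n d :: nat and lam :: real
    and M :: "'a measure" and X :: "real \<Rightarrow> 'a \<Rightarrow> state"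
    and M' :: "'b measure" and X' :: "real \<Rightarrow> 'b \<Rightarrow> state"
    and N :: "'c measure" and xi xi' :: "'c \<Rightarrow> state"
  assumes "1 \<le> d" and "d \<le> n" and "0 < lam" and "lam < 1"
    and "redundancy_chain n d lam M X"
    and "redundancy_chain n d lam M' X'"
    and "prob_space N"
    and "xi \<in> N \<rightarrow>\<^sub>M count_space (states n d)"
    and "xi' \<in> N \<rightarrow>\<^sub>M count_space (states n d)"
    and "distr N (count_space (states n d)) xi = distr M (count_space (states n d)) (X 0)"
    and "distr N (count_space (states n d)) xi' = distr M' (count_space (states n d)) (X' 0)"
    and "AE \<omega> in N. xi \<omega> \<le> xi' \<omega>"
  shows "(\<exists>(P :: path_pair measure) Y Y'.
            coupling (states n d) (generator n d lam) M X M' X' P Y Y' \<and>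
            (\<forall>\<omega>\<in>space P. \<forall>t\<ge>0. Y t \<omega> \<le> Y' t \<omega>)) \<and>
         (\<forall>t\<ge>0. stoch_le (states n d) M (X t) M' (X' t))"
proof -
  let ?S = "states n d" and ?Q = "generator n d lam"
  define u where "u = uniformized (real n * (1 + lam)) (step n d lam)"
  have S: "countable ?S"
    by (rule countable_states)
  have u: "transition_function ?S u" "has_generator ?S u ?Q"
    unfolding u_def using assms(1-3)
    by (intro transition_function_uniformized set_step has_generator_uniformized_step; simp)+
  have X: "\<And>t. 0 \<le> t \<Longrightarrow> X t \<in> M \<rightarrow>\<^sub>M count_space ?S" "prob_space M"
    and X': "\<And>t. 0 \<le> t \<Longrightarrow> X' t \<in> M' \<rightarrow>\<^sub>M count_space ?S" "prob_space M'"
    using assms(5,6) by (auto simp: markov_chain_def)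

  have pair: "(\<lambda>\<omega>. (xi \<omega>, xi' \<omega>)) \<in> N \<rightarrow>\<^sub>M count_space (?S \<times> ?S)"
    using measurable_Pair[OF assms(8,9)] by (simp add: pair_measure_countable[OF S S])
  note pair_UNIV = measurable_count_space_UNIV[OF pair]
  obtain \<nu> where \<nu>: "distr N (count_space UNIV) (\<lambda>\<omega>. (xi \<omega>, xi' \<omega>)) = measure_pmf \<nu>" "set_pmf \<nu> \<subseteq> ?S \<times> ?S"
    using distr_pmf_exists[OF assms(7) pair] S by auto
  \<comment> \<open>The almost sure order of the initial states becomes an order on the support of
    \<open>\<nu>\<close>, from which the coupled chain can start.\<close>
  have "AE w in distr N (count_space UNIV) (\<lambda>\<omega>. (xi \<omega>, xi' \<omega>)). fst w \<le> snd w"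
    using assms(12) pair_UNIV by (subst AE_distr_iff) auto
  then have ordered: "set_pmf \<nu> \<subseteq> ordered_pairs n d"
    using \<nu>(2) unfolding \<nu>(1) AE_measure_pmf_iff by (auto simp: ordered_pairs_def)
  have marginal: "distr N (count_space UNIV) (\<lambda>\<omega>. g (xi \<omega>, xi' \<omega>)) = measure_pmf (map_pmf g \<nu>)" for g :: "_ \<Rightarrow> state"
    unfolding map_pmf_rep_eq \<nu>(1)[symmetric] using pair_UNIV by (subst distr_distr) (auto simp: comp_def)
  have fdds: "has_fdds M X (map_pmf fst \<nu>) u"
    unfolding u_def using assms(1,2,3,5)
  proof (rule redundancy_chain_has_fdds)
    show "distr M (count_space UNIV) (X 0) = measure_pmf (map_pmf fst \<nu>)"
      using marginal[of fst] distr_count_space_UNIV[OF assms(8)] distr_count_space_UNIV[OF X(1)[of 0]] assms(10)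
      by simp
  qed
  have fdds': "has_fdds M' X' (map_pmf snd \<nu>) u"
    unfolding u_def using assms(1,2,3,6)
  proof (rule redundancy_chain_has_fdds)
    show "distr M' (count_space UNIV) (X' 0) = measure_pmf (map_pmf snd \<nu>)"
      using marginal[of snd] distr_count_space_UNIV[OF assms(9)] distr_count_space_UNIV[OF X'(1)[of 0]] assms(11)
      by simp
  qed

  obtain E :: "(real \<Rightarrow> real) measure" and V V' where E: "prob_space E"
    and le: "\<And>\<omega> t. \<omega> \<in> space E \<Longrightarrow> 0 \<le> t \<Longrightarrow> V t \<omega> \<le> V' t \<omega>"
    and V: "\<And>t. 0 \<le> t \<Longrightarrow> V t \<in> E \<rightarrow>\<^sub>M count_space ?S"
    and V': "\<And>t. 0 \<le> t \<Longrightarrow> V' t \<in> E \<rightarrow>\<^sub>M count_space ?S"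
    and V_fdds: "has_fdds E V (map_pmf fst \<nu>) u" and V'_fdds: "has_fdds E V' (map_pmf snd \<nu>) u"
    and right: "\<And>\<omega> t. \<omega> \<in> space E \<Longrightarrow> 0 \<le> t \<Longrightarrow> \<forall>\<^sub>F s in at_right t. V s \<omega> = V t \<omega>"
      "\<And>\<omega> t. \<omega> \<in> space E \<Longrightarrow> 0 \<le> t \<Longrightarrow> \<forall>\<^sub>F s in at_right t. V' s \<omega> = V' t \<omega>"
    by (rule ordered_chains_exist[OF assms(1-3) ordered, folded u_def]) (rule that)
  interpret E: prob_space E by (rule E)

  \<comment> \<open>These conditions involve uncountably many times, so \<open>R\<close> need not be
    measurable in the product. Restricting the space to \<open>R\<close> is still legitimate,
    because the measure is the image under a map \<open>\<Phi>\<close> with values in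
    \<open>R\<close>.\<close>
  define R :: "path_pair set" where "R = {w. \<forall>t\<ge>0. fst w t \<le> snd w t \<and>
    (\<forall>\<^sub>F s in at_right t. fst w s = fst w t) \<and> (\<forall>\<^sub>F s in at_right t. snd w s = snd w t)}"
  define B :: "path_pair measure" where
    "B = restrict_space ((\<Pi>\<^sub>M t\<in>{0..}. count_space ?S) \<Otimes>\<^sub>M (\<Pi>\<^sub>M t\<in>{0..}. count_space ?S)) R"
  define \<Phi> :: "_ \<Rightarrow> path_pair" where "\<Phi> \<omega> = (\<lambda>t\<in>{0..}. V t \<omega>, \<lambda>t\<in>{0..}. V' t \<omega>)" for \<omega>
  \<comment> \<open>Cutting paths off at negative times is harmless: immediately to the right of
    \<open>t \<ge> 0\<close> all times are nonnegative.\<close>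
  have right_restrict: "\<forall>\<^sub>F s in at_right t. restrict f {0..} s = restrict f {0..} t"
    if "\<forall>\<^sub>F s in at_right t. f s = f t" "0 \<le> t" for f :: "real \<Rightarrow> state" and t
    using that(1) eventually_at_right_less[of t] by eventually_elim (use that(2) in auto)
  have \<Phi>: "\<Phi> \<in> E \<rightarrow>\<^sub>M B"
    unfolding B_def
  proof (rule measurable_restrict_space2)
    show "\<Phi> \<in> space E \<rightarrow> R"
    proof
      fix \<omega> assume \<omega>: "\<omega> \<in> space E"
      have proj: "fst (\<Phi> \<omega>) = restrict (\<lambda>t. V t \<omega>) {0..}" "snd (\<Phi> \<omega>) = restrict (\<lambda>t. V' t \<omega>) {0..}"
        by (simp_all add: \<Phi>_def)
      show "\<Phi> \<omega> \<in> R"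
        unfolding R_def mem_Collect_eq proj
        using le[OF \<omega>] right_restrict[OF right(1)[OF \<omega>]] right_restrict[OF right(2)[OF \<omega>]]
        by (intro allI impI conjI) (simp, blast+)
    qed
    show "\<Phi> \<in> E \<rightarrow>\<^sub>M (\<Pi>\<^sub>M t\<in>{0..}. count_space ?S) \<Otimes>\<^sub>M (\<Pi>\<^sub>M t\<in>{0..}. count_space ?S)"
      unfolding \<Phi>_def[abs_def] using V V' by (intro measurable_Pair measurable_restrict) auto
  qed
  define P where "P = distr E B \<Phi>"
  define Y :: "real \<Rightarrow> path_pair \<Rightarrow> state" where "Y t w = fst w t" for t w
  define Y' :: "real \<Rightarrow> path_pair \<Rightarrow> state" where "Y' t w = snd w t" for t w
  have P: "prob_space P"
    unfolding P_def using \<Phi> by (rule E.prob_space_distr)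
  have Y: "Y t \<in> B \<rightarrow>\<^sub>M count_space ?S" and Y': "Y' t \<in> B \<rightarrow>\<^sub>M count_space ?S" if "0 \<le> t" for t
    unfolding Y_def[abs_def] Y'_def[abs_def] B_def using that
    by (intro measurable_restrict_space1 measurable_compose[OF measurable_fst]
        measurable_compose[OF measurable_snd] measurable_component_singleton; simp)+
  have YP: "Y t \<in> P \<rightarrow>\<^sub>M count_space ?S" and Y'P: "Y' t \<in> P \<rightarrow>\<^sub>M count_space ?S" if "0 \<le> t" for t
    using Y[OF that] Y'[OF that] by (simp_all add: P_def)
  have Y_fdds: "has_fdds P Y (map_pmf fst \<nu>) u"
    unfolding P_def by (rule has_fdds_distr[OF V_fdds \<Phi> S Y]) (simp_all add: Y_def \<Phi>_def)
  have Y'_fdds: "has_fdds P Y' (map_pmf snd \<nu>) u"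
    unfolding P_def by (rule has_fdds_distr[OF V'_fdds \<Phi> S Y']) (simp_all add: Y'_def \<Phi>_def)
  have space_P: "w \<in> R" if "w \<in> space P" for w
    using that by (simp add: P_def B_def space_restrict_space)
  have "markov_chain ?S ?Q P Y" "markov_chain ?S ?Q P Y'"
    using markov_chain_if_has_fdds[OF P S YP _ u Y_fdds] markov_chain_if_has_fdds[OF P S Y'P _ u Y'_fdds] space_P
    by (auto simp: R_def Y_def Y'_def)
  moreover have "process_law ?S P Y = process_law ?S M X"
    by (rule process_law_eqI[OF P X(2) S YP X(1) Y_fdds fdds])
  moreover have "process_law ?S P Y' = process_law ?S M' X'"
    by (rule process_law_eqI[OF P X'(2) S Y'P X'(1) Y'_fdds fdds'])
  ultimately have "coupling ?S ?Q M X M' X' P Y Y'"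
    by (simp add: coupling_def)
  moreover have "\<forall>\<omega>\<in>space P. \<forall>t\<ge>0. Y t \<omega> \<le> Y' t \<omega>"
    using space_P by (auto simp: R_def Y_def Y'_def)
  moreover have "stoch_le ?S M (X t) M' (X' t)" if t: "0 \<le> t" for t
    unfolding stoch_le_def
  proof (intro allI impI)
    fix f :: "state \<Rightarrow> real" assume "mono_on ?S f \<and> bounded (f ` ?S)"
    then have mono: "mono_on ?S f" and "bounded (f ` ?S)"
      by auto
    then obtain b where b: "\<And>x. x \<in> ?S \<Longrightarrow> norm (f x) \<le> b"
      by (auto simp: bounded_iff)
    have integrable: "integrable E (\<lambda>\<omega>. f (Z \<omega>))" if "Z \<in> E \<rightarrow>\<^sub>M count_space ?S" for Z
    proof (rule E.integrable_const_bound)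
      show "AE \<omega> in E. norm (f (Z \<omega>)) \<le> b"
        using measurable_space[OF that] b by auto
      show "(\<lambda>\<omega>. f (Z \<omega>)) \<in> borel_measurable E"
        using that by (rule measurable_compose) simp
    qed
    \<comment> \<open>Both expectations are moved to \<open>E\<close>, where \<open>V t\<close> and
      \<open>V' t\<close> are ordered pointwise and monotonicity of \<open>f\<close> applies under
      the integral.\<close>
    have "(\<integral>\<omega>. f (X t \<omega>) \<partial>M) = (\<integral>\<omega>. f (V t \<omega>) \<partial>E)"
      using integral_has_fdds[OF fdds S X(1) t, of f] integral_has_fdds[OF V_fdds S V t, of f] by simp
    also have "\<dots> \<le> (\<integral>\<omega>. f (V' t \<omega>) \<partial>E)"
      using measurable_space[OF V[OF t]] measurable_space[OF V'[OF t]] le t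
      by (intro integral_mono integrable V V' mono_onD[OF mono]) auto
    also have "\<dots> = (\<integral>\<omega>. f (X' t \<omega>) \<partial>M')"
      using integral_has_fdds[OF fdds' S X'(1) t, of f] integral_has_fdds[OF V'_fdds S V' t, of f] by simp
    finally show "(\<integral>\<omega>. f (X t \<omega>) \<partial>M) \<le> (\<integral>\<omega>. f (X' t \<omega>) \<partial>M')" .
  qed
  ultimately show ?thesis
    by blast
qed

end
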